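(* Let $\mathbb{G}=(G,\otimes)$ be a commutative group such that the operation $\otimes$ and the equality check are computable. Then the following problem is decidable: given a (trimmed) weighted automaton $W$ over $\mathbb{G}$ and a number $k$, does $W$ satisfy the branching twinning property of order $k$?
   Context: A weighted automaton on a finite alphabet $A$ over a group $\mathbb{G}$ is a tuple $W=(Q,t_{init},t_{final},T)$ with $Q$ a finite set of states, $t_{init},t_{final}\subseteq Q\times\mathbb{G}$ finite, and $T\subseteq Q\times A\times\mathbb{G}\times Q$ a finite set of transitions. A state $q$ is initial (resp. final) if $(q,\alpha)\in t_{init}$ (resp. $t_{final}$) for some $\alpha$. A run $p\xrightarrow{w|\alpha}q$ is a sequence of consecutive transitions from $p$ to $q$ reading $w$, with output $\alpha$ the product of the weights in order; it is accepting if $p$ is initial and $q$ is final. $W$ is trimmed if every state appears in some accepting run; weighted automata are assumed trimmed. $delay(\alpha,\beta)=\alpha^{-1}\beta$. Branching twinning property of order $k$ ($k\geq 1$): for all states $q_{i,j}$ ($0\le i,j\le k$) with every $q_{0,j}$ initial, all $\gamma_j$ with $(q_{0,j},\gamma_j)\in t_{init}$ ($0\le j\le k$), and all words $u_{i,j},v_{i,j}$ ($1\le i\le k$, $0\le j\le k$) for which there are runs $q_{i-1,j}\xrightarrow{u_{i,j}|\alpha_{i,j}}q_{i,j}$ and $q_{i,j}\xrightarrow{v_{i,j}|\beta_{i,j}}q_{i,j}$ for all such $i,j$, there are $j\ne j'$ such that for all $i\in\{1,\dots,k\}$: if $u_{i',j}=u_{i',j'}$ and $v_{i',j}=v_{i',j'}$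 for every $1\le i'\le i$, then $delay(\gamma_j\alpha_{1,j}\cdots\alpha_{i,j},\ \gamma_{j'}\alpha_{1,j'}\cdots\alpha_{i,j'})=delay(\gamma_j\alpha_{1,j}\cdots\alpha_{i,j}\beta_{i,j},\ \gamma_{j'}\alpha_{1,j'}\cdots\alpha_{i,j'}\beta_{i,j'})$. *)

theory Defs
  imports "HOL-Algebra.Group" "HOL-Library.Nat_Bijection"
begin

section \<open>Partial recursive functions\<close>

text \<open>Kleene's partial recursive functions: programs with a big-step semantics, where
  \<open>computes r xs y\<close> means that \<open>r\<close> halts on input \<open>xs\<close> with output \<open>y\<close>.
  Recursion and minimisation run on the first argument.\<close>

datatype recf =
    Zero
  | Succ
  | Proj nat
  | Comp recf "recf list"
  | Prim recf recf
  | Mu recf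

inductive computes :: "recf \<Rightarrow> nat list \<Rightarrow> nat \<Rightarrow> bool" where
  zero: "computes Zero xs 0"
| succ: "computes Succ [x] (Suc x)"
| proj: "i < length xs \<Longrightarrow> computes (Proj i) xs (xs ! i)"
| comp: "list_all2 (\<lambda>g y. computes g xs y) gs ys \<Longrightarrow> computes f ys z
          \<Longrightarrow> computes (Comp f gs) xs z"
| prim_0: "computes f xs y \<Longrightarrow> computes (Prim f g) (0 # xs) y"
| prim_Suc: "computes (Prim f g) (n # xs) y \<Longrightarrow> computes g (n # y # xs) z
          \<Longrightarrow> computes (Prim f g) (Suc n # xs) z"
| mu: "computes f (n # xs) 0 \<Longrightarrow> (\<forall>m<n. \<exists>y>0. computes f (m # xs) y)
          \<Longrightarrow> computes (Mu f) xs n"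
monos list_all2_mono

lemma computes_deterministic:
  assumes "computes r xs y" and "computes r xs z"
  shows "y = z"
  using assms
proof (induction arbitrary: z rule: computes.induct)
  case (zero xs)
  then show ?case by (cases rule: computes.cases) auto
next
  case (succ x)
  then show ?case by (cases rule: computes.cases) auto
next
  case (proj i xs)
  from proj.prems show ?case by (cases rule: computes.cases) auto
next
  case (prim_0 f xs y g)
  from prim_0.prems have "computes f xs z" by (cases rule: computes.cases) auto
  then show ?case by (rule prim_0.IH)
next
  case (prim_Suc f g n xs y w)
  from prim_Suc.prems obtain y' where
    "computes (Prim f g) (n # xs) y'" and "computes g (n # y' # xs) z"
    by (cases rule: computes.cases) auto
  then show ?case using prim_Suc.IH by blast
next
  case (comp xs gs ys f w)
  from comp.prems obtain ys' where
    ys': "list_all2 (\<lambda>g y. computes g xs y) gs ys'" and f: "computes f ys' z"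
    by (cases rule: computes.cases) auto
  have "ys = ys'"
  proof (rule nth_equalityI)
    show "length ys = length ys'"
      using comp.IH(1) ys' by (simp add: list_all2_conv_all_nth)
    show "ys ! i = ys' ! i" if "i < length ys" for i
      using comp.IH(1) ys' that by (simp add: list_all2_conv_all_nth)
  qed
  with f comp.IH(2) show ?case by blast
next
  case (mu f n xs)
  from mu.prems have z: "computes f (z # xs) 0" "\<forall>m<z. \<exists>y>0. computes f (m # xs) y"
    by (cases rule: computes.cases; blast)+
  show ?case
  proof (rule linorder_cases[of n z])
    assume "n < z" then show ?thesis using z(2) mu.IH(1) by fastforce
  next
    assume "z < n" then show ?thesis using z(1) mu.IH(2) by fastforce
  qed
qed

text \<open>A decision problem is given by its instances, a presentation of every instance as a
  tuple of numbers, and the question asked about it; only the behaviour of the decision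
  procedure on (presentations of) instances is constrained.\<close>

definition decidable_problem :: "('i \<Rightarrow> nat list) \<Rightarrow> 'i set \<Rightarrow> ('i \<Rightarrow> bool) \<Rightarrow> bool" where
  "decidable_problem enc I P \<longleftrightarrow>
     (\<exists>r. \<forall>x\<in>I. computes r (enc x) (if P x then 1 else 0))"


section \<open>Groups with computable operation and equality\<close>

text \<open>Group elements are named by natural numbers through a surjective, not necessarily
  injective numbering \<open>\<nu>\<close> (a constructive group in the sense of Mal'cev): an algorithm
  maps names of two elements to a name of their product, and another one decides whether two
  names denote the same element.\<close>

definition computable_numbering :: "('g, 'm) monoid_scheme \<Rightarrow> (nat \<Rightarrow> 'g) \<Rightarrow> bool" where
  "computable_numbering G \<nu> \<longleftrightarrow>
     range \<nu> = carrier G \<and>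
     (\<exists>r. \<forall>m n. \<exists>l. computes r [m, n] l \<and> \<nu> l = \<nu> m \<otimes>\<^bsub>G\<^esub> \<nu> n) \<and>
     decidable_problem (\<lambda>(m, n). [m, n]) UNIV (\<lambda>(m, n). \<nu> m = \<nu> n)"


section \<open>Weighted automata\<close>

type_synonym ('q, 'a, 'g) transition = "'q \<times> 'a \<times> 'g \<times> 'q"

record ('q, 'a, 'g) wautomaton =
  states :: "'q set"
  t_init :: "('q \<times> 'g) set"
  t_final :: "('q \<times> 'g) set"
  transitions :: "('q, 'a, 'g) transition set"

definition weighted_automaton ::
    "'g set \<Rightarrow> 'a set \<Rightarrow> ('q, 'a, 'g) wautomaton \<Rightarrow> bool" where
  "weighted_automaton C A W \<longleftrightarrow>
     finite A \<and> finite (states W) \<and>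
     t_init W \<subseteq> states W \<times> C \<and> finite (t_init W) \<and>
     t_final W \<subseteq> states W \<times> C \<and> finite (t_final W) \<and>
     transitions W \<subseteq> states W \<times> A \<times> C \<times> states W \<and> finite (transitions W)"

definition initial :: "('q, 'a, 'g) wautomaton \<Rightarrow> 'q \<Rightarrow> bool" where
  "initial W q \<longleftrightarrow> (\<exists>\<alpha>. (q, \<alpha>) \<in> t_init W)"

definition final :: "('q, 'a, 'g) wautomaton \<Rightarrow> 'q \<Rightarrow> bool" where
  "final W q \<longleftrightarrow> (\<exists>\<alpha>. (q, \<alpha>) \<in> t_final W)"

fun path :: "('q, 'a, 'g) wautomaton \<Rightarrow> 'q \<Rightarrow> ('q, 'a, 'g) transition list \<Rightarrow> 'q \<Rightarrow> bool" where
  "path W p [] q \<longleftrightarrow> p \<in> states W \<and> p = q"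
| "path W p ((p', a, \<alpha>, r) # \<rho>) q \<longleftrightarrow> (p', a, \<alpha>, r) \<in> transitions W \<and> p' = p \<and> path W r \<rho> q"

definition path_states :: "'q \<Rightarrow> ('q, 'a, 'g) transition list \<Rightarrow> 'q set" where
  "path_states p \<rho> = insert p ((\<lambda>(_, _, _, r). r) ` set \<rho>)"

definition trimmed :: "('q, 'a, 'g) wautomaton \<Rightarrow> bool" where
  "trimmed W \<longleftrightarrow>
     (\<forall>s\<in>states W. \<exists>p \<rho> q. initial W p \<and> path W p \<rho> q \<and> final W q \<and> s \<in> path_states p \<rho>)"

definition list_prod :: "('g, 'm) monoid_scheme \<Rightarrow> 'g list \<Rightarrow> 'g" where
  "list_prod G xs = foldr (\<otimes>\<^bsub>G\<^esub>) xs \<one>\<^bsub>G\<^esub>"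

definition run ::
    "('g, 'm) monoid_scheme \<Rightarrow> ('q, 'a, 'g) wautomaton \<Rightarrow> 'q \<Rightarrow> 'a list \<Rightarrow> 'g \<Rightarrow> 'q \<Rightarrow> bool" where
  "run G W p w \<alpha> q \<longleftrightarrow>
     (\<exists>\<rho>. path W p \<rho> q \<and> w = map (\<lambda>(_, a, _, _). a) \<rho> \<and>
          \<alpha> = list_prod G (map (\<lambda>(_, _, \<beta>, _). \<beta>) \<rho>))"

definition delay :: "('g, 'm) monoid_scheme \<Rightarrow> 'g \<Rightarrow> 'g \<Rightarrow> 'g" where
  "delay G \<alpha> \<beta> = inv\<^bsub>G\<^esub> \<alpha> \<otimes>\<^bsub>G\<^esub> \<beta>"

definition branching_twinning ::
    "('g, 'm) monoid_scheme \<Rightarrow> ('q, 'a, 'g) wautomaton \<Rightarrow> nat \<Rightarrow> bool" where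
  "branching_twinning G W k \<longleftrightarrow>
     (\<forall>(q :: nat \<Rightarrow> nat \<Rightarrow> 'q) (\<gamma> :: nat \<Rightarrow> 'g)
       (u :: nat \<Rightarrow> nat \<Rightarrow> 'a list) (v :: nat \<Rightarrow> nat \<Rightarrow> 'a list)
       (\<alpha> :: nat \<Rightarrow> nat \<Rightarrow> 'g) (\<beta> :: nat \<Rightarrow> nat \<Rightarrow> 'g).
       (\<forall>j\<le>k. initial W (q 0 j) \<and> (q 0 j, \<gamma> j) \<in> t_init W) \<and>
       (\<forall>i\<in>{1..k}. \<forall>j\<le>k.
          run G W (q (i - 1) j) (u i j) (\<alpha> i j) (q i j) \<and>
          run G W (q i j) (v i j) (\<beta> i j) (q i j))
       \<longrightarrow> (\<exists>j\<le>k. \<exists>j'\<le>k. j \<noteq> j' \<and>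
             (\<forall>i\<in>{1..k}.
                (\<forall>i'\<in>{1..i}. u i' j = u i' j' \<and> v i' j = v i' j') \<longrightarrow>
                (let out = (\<lambda>l. \<gamma> l \<otimes>\<^bsub>G\<^esub> list_prod G (map (\<lambda>i'. \<alpha> i' l) [1..<Suc i])) in
                 delay G (out j) (out j') =
                 delay G (out j \<otimes>\<^bsub>G\<^esub> \<beta> i j) (out j' \<otimes>\<^bsub>G\<^esub> \<beta> i j')))))"


section \<open>Presenting weighted automata as inputs\<close>

text \<open>An input automaton has numbers as states and letters, and its weights are names of
  group elements. The automaton over the group that it denotes is obtained by replacing
  names by what they denote; the sets of the input are themselves required to be finite.\<close>

definition denoted_automaton ::
    "(nat \<Rightarrow> 'g) \<Rightarrow> ('q, 'a, nat) wautomaton \<Rightarrow> ('q, 'a, 'g) wautomaton" where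
  "denoted_automaton \<nu> W =
     \<lparr> states = states W,
       t_init = (\<lambda>(q, c). (q, \<nu> c)) ` t_init W,
       t_final = (\<lambda>(q, c). (q, \<nu> c)) ` t_final W,
       transitions = (\<lambda>(p, a, c, q). (p, a, \<nu> c, q)) ` transitions W \<rparr>"

fun transition_encode :: "(nat, nat, nat) transition \<Rightarrow> nat" where
  "transition_encode (p, a, c, q) = prod_encode (p, prod_encode (a, prod_encode (c, q)))"

type_synonym wa_input = "nat set \<times> (nat, nat, nat) wautomaton \<times> nat"

fun input_encode :: "wa_input \<Rightarrow> nat list" where
  "input_encode (A, W, k) =
     [set_encode A, set_encode (states W),
      set_encode (prod_encode ` t_init W), set_encode (prod_encode ` t_final W),
      set_encode (transition_encode ` transitions W), k]"

definition trimmed_inputs :: "(nat \<Rightarrow> 'g) \<Rightarrow> wa_input set" where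
  "trimmed_inputs \<nu> =
     {(A, W, k). weighted_automaton UNIV A W \<and> trimmed (denoted_automaton \<nu> W) \<and> k \<ge> 1}"

lemma inj_transition_encode: "inj transition_encode"
  by (auto intro!: injI)

lemma inj_on_input_encode: "inj_on input_encode (trimmed_inputs \<nu>)"
proof (rule inj_onI)
  fix x y assume xy: "x \<in> trimmed_inputs \<nu>" "y \<in> trimmed_inputs \<nu>"
    "input_encode x = input_encode y"
  obtain A W k A' W' k' where [simp]: "x = (A, W, k)" "y = (A', W', k')"
    by (cases x, cases y)
  have "A = A'" "states W = states W'" "k = k'" "prod_encode ` t_init W = prod_encode ` t_init W'"
    "prod_encode ` t_final W = prod_encode ` t_final W'"
    "transition_encode ` transitions W = transition_encode ` transitions W'"
    using xy by (simp_all add: trimmed_inputs_def weighted_automaton_def set_encode_eq)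
  then show "x = y"
    by (simp add: inj_image_eq_iff inj_prod_encode inj_transition_encode)
qed

lemma weighted_automaton_denoted:
  assumes "computable_numbering G \<nu>" and "weighted_automaton UNIV A W"
  shows "weighted_automaton (carrier G) A (denoted_automaton \<nu> W)"
  using assms unfolding computable_numbering_def weighted_automaton_def denoted_automaton_def
  by fastforce

lemma weighted_automaton_has_input:
  assumes "computable_numbering G \<nu>" and "weighted_automaton (carrier G) A V"
  obtains W where "weighted_automaton UNIV A W" and "denoted_automaton \<nu> W = V"
proof -
  define c where "c = inv_into UNIV \<nu>"
  have c: "\<nu> (c x) = x" if "x \<in> carrier G" for x
    using assms(1) that by (simp add: c_def computable_numbering_def f_inv_into_f)
  define W where "W =
     \<lparr> states = states V,
       t_init = (\<lambda>(q, x). (q, c x)) ` t_init V,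
       t_final = (\<lambda>(q, x). (q, c x)) ` t_final V,
       transitions = (\<lambda>(p, a, x, q). (p, a, c x, q)) ` transitions V \<rparr>"
  have "weighted_automaton UNIV A W"
    using assms(2) by (auto simp: W_def weighted_automaton_def)
  moreover have "denoted_automaton \<nu> W = V"
  proof -
    have id: "f ` S = S" if "\<forall>x\<in>S. f x = x" for f :: "'z \<Rightarrow> 'z" and S
      using that by force
    have V: "t_init V \<subseteq> UNIV \<times> carrier G" "t_final V \<subseteq> UNIV \<times> carrier G"
      "transitions V \<subseteq> UNIV \<times> UNIV \<times> carrier G \<times> UNIV"
      using assms(2) by (auto simp: weighted_automaton_def)
    have "(\<lambda>(q, x). (q, \<nu> (c x))) ` t_init V = t_init V"
      "(\<lambda>(q, x). (q, \<nu> (c x))) ` t_final V = t_final V"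
      "(\<lambda>(p, a, x, q). (p, a, \<nu> (c x), q)) ` transitions V = transitions V"
      using V by (intro id; force simp: c)+
    then show ?thesis
      by (simp add: W_def denoted_automaton_def image_image case_prod_unfold)
  qed
  ultimately show ?thesis by (rule that)
qed

end

theory Submission imports Defs begin

text \<open>In a commutative group the equality of delays in the twinning property says just that the two loops
  have the same output. A counterexample therefore consists of \<open>k + 1\<close> runs such that any two of them
  have, while they still read the same words, a pair of loops with different outputs. It suffices
  to bound the length of the words in a counterexample: then it can be searched for.

  Consider all runs that have read the same words so far, as one joint run. If it reads a
  long word then it visits some joint state at many positions, and cutting out the part between two of
  these keeps the runs valid. Colour a pair of positions by a pair of runs whose outputs differ
  but become equal by that cut. This means that the cut parts account for the whole difference
  \<open>d \<noteq> 1\<close> of the outputs; a triangle of one colour would give \<open>d = d\<^sup>2\<close>. By Ramsey's theorem some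
  pair of positions has no colour, and cutting there gives a shorter counterexample.\<close>

section \<open>Computable functions and predicates\<close>

text \<open>Arguments are given as an environment, of which only the first \<open>n\<close> values may matter. A bound
  variable is pushed to the front of the environment; all closure rules below have higher-order
  patterns as conclusions, so that computability of a term follows by resolution.\<close>
definition computable_fun :: "nat \<Rightarrow> ((nat \<Rightarrow> nat) \<Rightarrow> nat) \<Rightarrow> bool" where
  "computable_fun n f \<longleftrightarrow> (\<exists>r. \<forall>e. computes r (map e [0..<n]) (f e))"

definition decidable_pred :: "nat \<Rightarrow> ((nat \<Rightarrow> nat) \<Rightarrow> bool) \<Rightarrow> bool" where
  "decidable_pred n P \<longleftrightarrow> computable_fun n (\<lambda>e. of_bool (P e))"

section \<open>Environments, composition and primitive recursion\<close>

lemma upt_Suc_conv_map: "[0..<Suc n] = 0 # map Suc [0..<n]"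
  by (simp add: upt_conv_Cons map_Suc_upt del: upt_Suc)

lemma map_case_nat: "map (case_nat i e) [0..<Suc n] = i # map e [0..<n]"
  by (simp add: upt_Suc_conv_map del: upt_Suc)

lemma computable_var: "i < n \<Longrightarrow> computable_fun n (\<lambda>e. e i)"
  unfolding computable_fun_def
proof (intro exI allI)
  fix e :: "nat \<Rightarrow> nat" assume "i < n"
  then show "computes (Proj i) (map e [0..<n]) (e i)"
    using computes.proj[of i "map e [0..<n]"] by simp
qed

lemma computable_comp1:
  assumes "computable_fun 1 (\<lambda>e. g (e 0))" "computable_fun n f"
  shows "computable_fun n (\<lambda>e. g (f e))"
proof -
  obtain r s where r: "\<And>e. computes r (map e [0..<1]) (g (e 0))"
    and s: "\<And>e. computes s (map e [0..<n]) (f e)"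
    using assms unfolding computable_fun_def by blast
  have "computes (Comp r [s]) (map e [0..<n]) (g (f e))" for e
    by (rule computes.comp[of _ _ "[f e]"]) (use r[of "\<lambda>_. f e"] s[of e] in auto)
  then show ?thesis unfolding computable_fun_def by blast
qed

text \<open>Lets an operation be proved computable on two variables first. A recursion whose step
  refers to an operand would otherwise need the program of that operand adapted to the longer
  environment of the step.\<close>

lemma computable_comp2:
  assumes "computable_fun 2 (\<lambda>e. g (e 0) (e 1))" "computable_fun n f" "computable_fun n h"
  shows "computable_fun n (\<lambda>e. g (f e) (h e))"
proof -
  obtain r s t where r: "\<And>e. computes r (map e [0..<2]) (g (e 0) (e 1))"
    and s: "\<And>e. computes s (map e [0..<n]) (f e)"
    and t: "\<And>e. computes t (map e [0..<n]) (h e)"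
    using assms unfolding computable_fun_def by blast
  have "computes (Comp r [s, t]) (map e [0..<n]) (g (f e) (h e))" for e
    by (rule computes.comp[of _ _ "[f e, h e]"])
       (use r[of "case_nat (f e) (\<lambda>_. h e)"] s[of e] t[of e] in \<open>auto simp: numeral_2_eq_2\<close>)
  then show ?thesis unfolding computable_fun_def by blast
qed

section \<open>Arithmetic and propositional operations\<close>

lemma computable_Suc: "computable_fun n f \<Longrightarrow> computable_fun n (\<lambda>e. Suc (f e))"
proof (rule computable_comp1[where g = Suc])
  have "computes Succ (map e [0..<1]) (Suc (e 0))" for e
    using computes.succ by simp
  then show "computable_fun 1 (\<lambda>e. Suc (e 0))" unfolding computable_fun_def by blast
qed

lemma computable_const: "computable_fun n (\<lambda>e. c)"
proof (induction c)
  case 0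
  show ?case unfolding computable_fun_def using computes.zero by blast
qed (rule computable_Suc)

text \<open>\<open>Prim\<close> recurses on its first argument, which need not be a variable here:
  the program for \<open>m\<close> is composed in, with projections passing on the environment as
  parameters. In the step, positions 0 and 1 hold the index and the previous value.\<close>

lemma computable_rec:
  assumes "computable_fun n b"
    and "computable_fun (Suc (Suc n)) (\<lambda>e. g (\<lambda>m. e (Suc (Suc m))) (e 0) (e (Suc 0)))"
    and "computable_fun n m"
  shows "computable_fun n (\<lambda>e. rec_nat (b e) (\<lambda>i y. g e i y) (m e))"
proof -
  obtain r s t where r: "\<And>e. computes r (map e [0..<n]) (b e)"
    and s: "\<And>e. computes s (map e [0..<Suc (Suc n)])
              (g (\<lambda>m. e (Suc (Suc m))) (e 0) (e (Suc 0)))"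
    and t: "\<And>e. computes t (map e [0..<n]) (m e)"
    using assms unfolding computable_fun_def by blast
  have prim: "computes (Prim r s) (i # map e [0..<n]) (rec_nat (b e) (g e) i)" for i e
  proof (induction i)
    case 0
    show ?case by (simp add: computes.prim_0 r)
  next
    case (Suc i)
    let ?e = "case_nat i (case_nat (rec_nat (b e) (g e) i) e)"
    have "computes s (i # rec_nat (b e) (g e) i # map e [0..<n]) (g e i (rec_nat (b e) (g e) i))"
      using s[of ?e] unfolding map_case_nat by simp
    then show ?case using computes.prim_Suc[OF Suc] by simp
  qed
  have "computes (Comp (Prim r s) (t # map Proj [0..<n])) (map e [0..<n])
          (rec_nat (b e) (g e) (m e))" for e
  proof (rule computes.comp[OF _ prim])
    show "list_all2 (\<lambda>g. computes g (map e [0..<n])) (t # map Proj [0..<n])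
            (m e # map e [0..<n])"
      using t[of e] computes.proj[of _ "map e [0..<n]"]
      by (auto simp: list_all2_conv_all_nth nth_Cons split: nat.split)
  qed
  then show ?thesis unfolding computable_fun_def by blast
qed

lemma computable_add: "computable_fun n f \<Longrightarrow> computable_fun n g \<Longrightarrow> computable_fun n (\<lambda>e. f e + g e)"
proof -
  assume "computable_fun n f" "computable_fun n g"
  then have "computable_fun n (\<lambda>e. rec_nat (g e) (\<lambda>i y. Suc y) (f e))"
    by (intro computable_rec computable_Suc computable_var) simp_all
  moreover have "rec_nat b (\<lambda>i y. Suc y) a = a + b" for a b :: nat
    by (induction a) auto
  ultimately show ?thesis by simp
qed

lemma computable_mult: "computable_fun n f \<Longrightarrow> computable_fun n g \<Longrightarrow> computable_fun n (\<lambda>e. f e * g e)"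
proof -
  assume *: "computable_fun n f" "computable_fun n g"
  have "computable_fun 2 (\<lambda>e. rec_nat 0 (\<lambda>i y. e 1 + y) (e 0))"
    by (intro computable_rec computable_add computable_var computable_const) simp_all
  moreover have "rec_nat 0 (\<lambda>i y. b + y) a = a * b" for a b :: nat
    by (induction a) auto
  ultimately have "computable_fun 2 (\<lambda>e. e 0 * e 1)" by simp
  from computable_comp2[OF this *] show ?thesis .
qed

lemma computable_power: "computable_fun n f \<Longrightarrow> computable_fun n g \<Longrightarrow> computable_fun n (\<lambda>e. f e ^ g e)"
proof -
  assume *: "computable_fun n f" "computable_fun n g"
  have "computable_fun 2 (\<lambda>e. rec_nat 1 (\<lambda>i y. e 0 * y) (e 1))"
    by (intro computable_rec computable_mult computable_var computable_const) simp_all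
  moreover have "rec_nat 1 (\<lambda>i y. a * y) b = a ^ b" for a b :: nat
    by (induction b) auto
  ultimately have "computable_fun 2 (\<lambda>e. e 0 ^ e 1)" by simp
  from computable_comp2[OF this *] show ?thesis .
qed

lemma computable_diff: "computable_fun n f \<Longrightarrow> computable_fun n g \<Longrightarrow> computable_fun n (\<lambda>e. f e - g e)"
proof -
  assume *: "computable_fun n f" "computable_fun n g"
  \<comment> \<open>A recursion that returns its index and ignores the previous value yields the
    predecessor; iterating the latter yields truncated subtraction.\<close>
  have "computable_fun 1 (\<lambda>e. rec_nat 0 (\<lambda>i y. i) (e 0))"
    by (intro computable_rec computable_var computable_const) simp_all
  moreover have "rec_nat 0 (\<lambda>i y. i) a = a - 1" for a :: nat
    by (cases a) auto
  ultimately have "computable_fun 1 (\<lambda>e. e 0 - 1)" by simp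
  \<comment> \<open>In the step of a recursion over two variables the environment has four entries,
    with the previous value at position 1.\<close>
  then have "computable_fun 4 (\<lambda>e. e 1 - 1)"
    by (rule computable_comp1) (simp add: computable_var)
  then have "computable_fun 2 (\<lambda>e. rec_nat (e 0) (\<lambda>i y. y - 1) (e 1))"
    by (intro computable_rec computable_var) simp_all
  moreover have "rec_nat a (\<lambda>i y. y - 1) b = a - b" for a b :: nat
    by (induction b) auto
  ultimately have "computable_fun 2 (\<lambda>e. e 0 - e 1)" by simp
  from computable_comp2[OF this *] show ?thesis .
qed

text \<open>Truncated subtraction gives \<open>f e - g e = 0\<close> exactly when the inequality
  holds.\<close>

lemma decidable_le: "computable_fun n f \<Longrightarrow> computable_fun n g \<Longrightarrow> decidable_pred n (\<lambda>e. f e \<le> g e)"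
proof -
  assume "computable_fun n f" "computable_fun n g"
  then have "computable_fun n (\<lambda>e. 1 - (f e - g e))"
    by (intro computable_diff computable_const)
  moreover have "1 - (a - b) = of_bool (a \<le> b)" for a b :: nat by auto
  ultimately show ?thesis by (simp only: decidable_pred_def)
qed

lemma decidable_not: "decidable_pred n P \<Longrightarrow> decidable_pred n (\<lambda>e. \<not> P e)"
proof -
  assume "decidable_pred n P"
  then have "computable_fun n (\<lambda>e. 1 - of_bool (P e))"
    unfolding decidable_pred_def by (intro computable_diff computable_const)
  moreover have "1 - of_bool p = (of_bool (\<not> p) :: nat)" for p by auto
  ultimately show ?thesis by (simp only: decidable_pred_def)
qed

lemma decidable_conj: "decidable_pred n P \<Longrightarrow> decidable_pred n Q \<Longrightarrow> decidable_pred n (\<lambda>e. P e \<and> Q e)"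
proof -
  assume "decidable_pred n P" "decidable_pred n Q"
  then have "computable_fun n (\<lambda>e. of_bool (P e) * of_bool (Q e))"
    unfolding decidable_pred_def by (rule computable_mult)
  moreover have "of_bool p * of_bool q = (of_bool (p \<and> q) :: nat)" for p q by auto
  ultimately show ?thesis by (simp only: decidable_pred_def)
qed

lemma decidable_less: "computable_fun n f \<Longrightarrow> computable_fun n g \<Longrightarrow> decidable_pred n (\<lambda>e. f e < g e)"
  using decidable_not[OF decidable_le, of n g f] by (simp add: not_le)

lemma decidable_eq: "computable_fun n f \<Longrightarrow> computable_fun n g \<Longrightarrow> decidable_pred n (\<lambda>e. f e = g e)"
  using decidable_conj[OF decidable_le decidable_le, of n f g g f] by (simp add: eq_iff)

lemma decidable_imp: "decidable_pred n P \<Longrightarrow> decidable_pred n Q \<Longrightarrow> decidable_pred n (\<lambda>e. P e \<longrightarrow> Q e)"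
  using decidable_not[OF decidable_conj[OF _ decidable_not], of n P Q] by simp

section \<open>Bounded counting, bounded quantifiers, and codes of pairs and sets\<close>

text \<open>The count is a sum of truth values, formed by primitive recursion. Bounded quantifiers
  and division are derived from it.\<close>

lemma computable_card_less:
  assumes "computable_fun n b" "decidable_pred (Suc n) (\<lambda>e. P (\<lambda>m. e (Suc m)) (e 0))"
  shows "computable_fun n (\<lambda>e. card {i. i < b e \<and> P e i})"
proof -
  have "computable_fun (Suc (Suc n)) (\<lambda>e. of_bool (P (\<lambda>m. e (Suc (Suc m))) (e 0)))"
  proof -
    obtain r where r: "\<And>e. computes r (map e [0..<Suc n]) (of_bool (P (\<lambda>m. e (Suc m)) (e 0)))"
      using assms(2) unfolding decidable_pred_def computable_fun_def by blast
    \<comment> \<open>In the step of the recursion the running count sits at position 1, which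
      \<open>P\<close> must not see; the projections skip it.\<close>
    have "computes (Comp r (Proj 0 # map (\<lambda>i. Proj (Suc (Suc i))) [0..<n]))
            (map e [0..<Suc (Suc n)]) (of_bool (P (\<lambda>m. e (Suc (Suc m))) (e 0)))" for e
    proof (rule computes.comp)
      let ?e = "case_nat (e 0) (\<lambda>m. e (Suc (Suc m)))"
      show "computes r (map ?e [0..<Suc n]) (of_bool (P (\<lambda>m. e (Suc (Suc m))) (e 0)))"
        using r[of ?e] by simp
      show "list_all2 (\<lambda>g. computes g (map e [0..<Suc (Suc n)]))
              (Proj 0 # map (\<lambda>i. Proj (Suc (Suc i))) [0..<n]) (map ?e [0..<Suc n])"
        unfolding map_case_nat
        using computes.proj[of _ "map e [0..<Suc (Suc n)]"]
        by (auto simp: list_all2_conv_all_nth nth_Cons split: nat.split simp del: upt_Suc)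
    qed
    then show ?thesis unfolding computable_fun_def by blast
  qed
  with assms(1) have "computable_fun n (\<lambda>e. rec_nat 0 (\<lambda>i y. y + of_bool (P e i)) (b e))"
    by (intro computable_rec computable_add computable_const computable_var) simp_all
  moreover have "rec_nat 0 (\<lambda>i y. y + of_bool (Q i)) a = card {i. i < a \<and> Q i}"
    for a and Q :: "nat \<Rightarrow> bool"
  proof (induction a)
    case (Suc a)
    have "{i. i < Suc a \<and> Q i} = (if Q a then insert a else id) {i. i < a \<and> Q i}"
      by (auto simp: less_Suc_eq)
    then show ?case using Suc by simp
  qed simp
  ultimately show ?thesis by simp
qed

lemma decidable_ex_less:
  assumes "computable_fun n b" "decidable_pred (Suc n) (\<lambda>e. P (\<lambda>m. e (Suc m)) (e 0))"
  shows "decidable_pred n (\<lambda>e. \<exists>i<b e. P e i)"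
proof -
  have "decidable_pred n (\<lambda>e. 0 < card {i. i < b e \<and> P e i})"
    using assms by (intro decidable_less computable_const computable_card_less)
  then show ?thesis by (simp add: card_gt_0_iff)
qed

lemma decidable_all_less:
  assumes "computable_fun n b" "decidable_pred (Suc n) (\<lambda>e. P (\<lambda>m. e (Suc m)) (e 0))"
  shows "decidable_pred n (\<lambda>e. \<forall>i<b e. P e i)"
  using decidable_not[OF decidable_ex_less[OF assms(1) decidable_not[OF assms(2)]]] by simp

text \<open>For a positive divisor the quotient counts the \<open>i\<close> whose successor times
  the divisor does not exceed the dividend; the condition \<open>0 < e 1\<close> gives 0 on division
  by zero, as \<open>div\<close> does.\<close>

lemma computable_div:
  assumes "computable_fun n f" "computable_fun n g"
  shows "computable_fun n (\<lambda>e. f e div g e)"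
proof -
  have "computable_fun 2 (\<lambda>e. card {i. i < e 0 \<and> (0 < e 1 \<and> Suc i * e 1 \<le> e 0)})"
    by (intro computable_card_less decidable_conj decidable_le decidable_less
        computable_mult computable_var computable_const computable_Suc) simp_all
  moreover have "{i. i < a \<and> (0 < b \<and> Suc i * b \<le> a)} = {..<a div b}" for a b :: nat
  proof (cases "b = 0")
    case False
    then have "Suc i * b \<le> a \<longleftrightarrow> i < a div b" for i
      by (metis Suc_le_eq less_eq_div_iff_mult_less_eq neq0_conv)
    then show ?thesis using False by (auto intro: less_le_trans[OF _ div_le_dividend])
  qed simp
  ultimately have "computable_fun 2 (\<lambda>e. e 0 div e 1)" by simp
  from computable_comp2[OF this assms] show ?thesis .
qed

lemma computable_mod:
  assumes "computable_fun n f" "computable_fun n g"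
  shows "computable_fun n (\<lambda>e. f e mod g e)"
proof -
  have "computable_fun n (\<lambda>e. f e - f e div g e * g e)"
    using assms by (intro computable_diff computable_mult computable_div)
  then show ?thesis by (simp add: minus_div_mult_eq_mod)
qed

lemma computable_prod_encode:
  assumes "computable_fun n f" "computable_fun n g"
  shows "computable_fun n (\<lambda>e. prod_encode (f e, g e))"
  unfolding prod_encode_def triangle_def prod.case
  using assms by (intro computable_add computable_div computable_mult computable_Suc computable_const)

text \<open>Membership in a decoded set is a test of a single binary digit.\<close>

lemma decidable_mem_set_decode:
  assumes "computable_fun n f" "computable_fun n g"
  shows "decidable_pred n (\<lambda>e. f e \<in> set_decode (g e))"
proof -
  have "decidable_pred n (\<lambda>e. g e div 2 ^ f e mod 2 = 1)"
    using assms by (intro decidable_eq computable_mod computable_div computable_power computable_const)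
  then show ?thesis by (simp add: set_decode_def odd_iff_mod_2_eq_one)
qed

lemmas computable_intros = computable_var computable_const computable_rec computable_Suc
  computable_add computable_mult computable_power computable_diff computable_div computable_mod
  computable_prod_encode decidable_le decidable_not decidable_conj decidable_less decidable_eq
  decidable_imp decidable_ex_less decidable_all_less decidable_mem_set_decode

section \<open>Shortening joint runs\<close>

text \<open>A crude bound, but explicit: the decision procedure has to compute it.\<close>
lemma no_monochromatic_triangle_card:
  fixes X :: "nat set"
  assumes "finite D" "finite X"
    and "\<And>a b. a \<in> X \<Longrightarrow> b \<in> X \<Longrightarrow> a < b \<Longrightarrow> \<exists>d\<in>D. R d a b"
    and "\<And>d a b c. d \<in> D \<Longrightarrow> a < b \<Longrightarrow> b < c \<Longrightarrow> R d a b \<Longrightarrow> R d b c \<Longrightarrow> \<not> R d a c"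
  shows "card X \<le> Suc (card D) ^ card D"
  using assms
proof (induction "card D" arbitrary: D X)
  case 0
  have "card X \<le> 1"
  proof (rule ccontr)
    assume "\<not> card X \<le> 1"
    then have "\<not> (\<exists>a. X \<subseteq> {a})" using card_mono[of "{_}" X] 0 by fastforce
    then obtain a b where "a \<in> X" "b \<in> X" "a < b"
      by (metis insertCI linorder_less_linear singleton_iff subsetI)
    then show False using 0 by auto
  qed
  then show ?case using 0 by (metis power_0)
next
  case (Suc n)
  show ?case
  proof (cases "X = {}")
    case False
    define a where "a = Min X"
    have a: "a \<in> X" "\<And>b. b \<in> X - {a} \<Longrightarrow> a < b"
      using False Suc.prems(2) by (auto simp: a_def order.not_eq_order_implies_strict)
    \<comment> \<open>Among the points joined to \<open>a\<close> in colour \<open>d\<close>, no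
      pair has colour \<open>d\<close>, as it would close a triangle with \<open>a\<close>; so the
      induction hypothesis applies with one colour less.\<close>
    have fibre: "card {b \<in> X - {a}. R d a b} \<le> Suc n ^ n" if d: "d \<in> D" for d
    proof -
      let ?Y = "{b \<in> X - {a}. R d a b}"
      have n: "n = card (D - {d})" using Suc.hyps(2) d Suc.prems(1) by simp
      show ?thesis unfolding n
      proof (rule Suc.hyps(1)[OF n])
        show "\<exists>d'\<in>D - {d}. R d' b c" if "b \<in> ?Y" "c \<in> ?Y" "b < c" for b c
          using that Suc.prems(3)[of b c] Suc.prems(4)[OF d, of a b c] a(2) by auto
      qed (use Suc.prems in auto)
    qed
    have "X - {a} \<subseteq> (\<Union>d\<in>D. {b \<in> X - {a}. R d a b})"
      using a Suc.prems(3) by blast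
    then have "card (X - {a}) \<le> card (\<Union>d\<in>D. {b \<in> X - {a}. R d a b})"
      using Suc.prems by (intro card_mono) auto
    also have "\<dots> \<le> (\<Sum>d\<in>D. card {b \<in> X - {a}. R d a b})"
      using Suc.prems(1) by (rule card_UN_le)
    also have "\<dots> \<le> card D * Suc n ^ n"
      using sum_bounded_above[of D _ "Suc n ^ n"] fibre by simp
    also have "\<dots> = card D ^ card D" by (simp flip: Suc.hyps(2))
    \<comment> \<open>Strictness leaves room for the least element \<open>a\<close>, which the
      fibres omit.\<close>
    also have "\<dots> < Suc (card D) ^ card D"
      by (simp add: power_strict_mono flip: Suc.hyps(2) del: power_Suc)
    finally show ?thesis using a(1) Suc.prems(2) by simp
  qed simp
qed

section \<open>Concatenation of paths, and their outputs\<close>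

text \<open>An empty path requires its state to lie in \<open>states W\<close>; the hypothesis on
  \<open>transitions W\<close> supplies this when the first part is empty.\<close>

lemma path_append:
  assumes "transitions W \<subseteq> states W \<times> A \<times> C \<times> states W"
  shows "path W p (xs @ ys) q \<longleftrightarrow> (\<exists>r. path W p xs r \<and> path W r ys q)"
proof (induction xs arbitrary: p)
  case Nil
  have "path W p ys q \<Longrightarrow> p \<in> states W"
    using assms by (cases ys) auto
  then show ?case by auto
qed auto

lemma path_states_mem:
  assumes "transitions W \<subseteq> states W \<times> A \<times> C \<times> states W" "path W p \<rho> q"
  shows "p \<in> states W" "q \<in> states W"
proof -
  show "p \<in> states W" using assms by (cases \<rho>) auto
  show "q \<in> states W" using assms(2) by (induction \<rho> arbitrary: p) auto
qed

definition word :: "('q, 'a, 'c) transition list \<Rightarrow> 'a list" where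
  "word \<rho> = map (\<lambda>(_, a, _, _). a) \<rho>"

text \<open>Transitions keep the names of weights, and \<open>\<nu>\<close> is applied only when the
  output is formed, so that runs of the denoted automaton can be handled as paths of the input
  automaton.\<close>

definition weight :: "('g, 'm) monoid_scheme \<Rightarrow> ('c \<Rightarrow> 'g) \<Rightarrow> ('q, 'a, 'c) transition list \<Rightarrow> 'g" where
  "weight G \<nu> \<rho> = list_prod G (map (\<lambda>(_, _, c, _). \<nu> c) \<rho>)"

context comm_group begin

lemma list_prod_closed: "set xs \<subseteq> carrier G \<Longrightarrow> list_prod G xs \<in> carrier G"
  by (induction xs) (auto simp: list_prod_def)

lemma list_prod_append:
  "set xs \<subseteq> carrier G \<Longrightarrow> set ys \<subseteq> carrier G \<Longrightarrow>
    list_prod G (xs @ ys) = list_prod G xs \<otimes> list_prod G ys"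
proof (induction xs)
  case Nil
  then show ?case using list_prod_closed by (simp add: list_prod_def)
next
  case (Cons x xs)
  then show ?case
    using list_prod_closed[of xs] list_prod_closed[of ys] by (simp add: list_prod_def m_assoc)
qed

text \<open>For \<open>x\<close>, \<open>y\<close>, \<open>z\<close>, \<open>w\<close> the outputs of the four pieces of two runs: if deleting either of two
  adjacent pieces, or both, makes the outputs agree, then they agreed from the start.\<close>
lemma equal_excess_imp_equal:
  assumes c: "x1 \<in> carrier G" "y1 \<in> carrier G" "z1 \<in> carrier G" "w1 \<in> carrier G"
    "x2 \<in> carrier G" "y2 \<in> carrier G" "z2 \<in> carrier G" "w2 \<in> carrier G"
    and 1: "x1 \<otimes> (z1 \<otimes> w1) = x2 \<otimes> (z2 \<otimes> w2)"
    and 2: "x1 \<otimes> y1 \<otimes> w1 = x2 \<otimes> y2 \<otimes> w2"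
    and 3: "x1 \<otimes> w1 = x2 \<otimes> w2"
  shows "x1 \<otimes> (y1 \<otimes> (z1 \<otimes> w1)) = x2 \<otimes> (y2 \<otimes> (z2 \<otimes> w2))"
proof -
  have "z1 \<otimes> (x1 \<otimes> w1) = z2 \<otimes> (x1 \<otimes> w1)" using 1 c by (metis 3 m_lcomm m_closed)
  then have z: "z1 = z2" using c by simp
  have "y1 \<otimes> (x1 \<otimes> w1) = y2 \<otimes> (x1 \<otimes> w1)" using 2 c by (metis 3 m_lcomm m_assoc m_closed)
  then have "y1 = y2" using c by simp
  then show ?thesis using c 3 z by (metis m_lcomm m_closed)
qed

context
  fixes \<nu> :: "'c \<Rightarrow> 'a" assumes \<nu>: "range \<nu> \<subseteq> carrier G"
begin

lemma weight_closed: "weight G \<nu> \<rho> \<in> carrier G"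
  unfolding weight_def using \<nu> by (intro list_prod_closed) auto

lemma weight_append: "weight G \<nu> (\<rho> @ \<sigma>) = weight G \<nu> \<rho> \<otimes> weight G \<nu> \<sigma>"
  unfolding weight_def map_append using \<nu> by (intro list_prod_append) auto

text \<open>Pigeonhole over the \<open>l + 1\<close> positions yields more than
  \<open>Suc ?K ^ ?K\<close> of them with one joint state, where \<open>?K\<close> bounds the number
  of ordered pairs of runs, that is, of colours. The bound for colourings without monochromatic
  triangles then gives two positions whose cut equates no pair of different outputs.\<close>

lemma joint_paths_shrink:
  assumes W: "transitions W \<subseteq> states W \<times> A \<times> D \<times> states W" "finite (states W)"
    and C: "finite C"
    and path: "\<And>j. j \<in> C \<Longrightarrow> path W (p j) (\<rho> j) (q j)"
    and len: "\<And>j. j \<in> C \<Longrightarrow> length (\<rho> j) = l"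
    and long: "l \<ge> card (states W) ^ card C * Suc (card C * card C) ^ (card C * card C)"
  obtains a b where "a < b" "b \<le> l"
    "\<And>j. j \<in> C \<Longrightarrow> path W (p j) (take a (\<rho> j) @ drop b (\<rho> j)) (q j)"
    "\<And>j j'. j \<in> C \<Longrightarrow> j' \<in> C \<Longrightarrow> weight G \<nu> (\<rho> j) \<noteq> weight G \<nu> (\<rho> j') \<Longrightarrow>
      weight G \<nu> (take a (\<rho> j) @ drop b (\<rho> j)) \<noteq> weight G \<nu> (take a (\<rho> j') @ drop b (\<rho> j'))"
proof -
  have "\<exists>r. path W (p j) (take a (\<rho> j)) r \<and> path W r (drop a (\<rho> j)) (q j)" if "j \<in> C" for a j
    using path[OF that] path_append[OF W(1), of "p j" "take a (\<rho> j)" "drop a (\<rho> j)"] by simp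
  then have "\<forall>a. \<exists>s. \<forall>j\<in>C. path W (p j) (take a (\<rho> j)) (s j) \<and> path W (s j) (drop a (\<rho> j)) (q j)"
    by (intro allI bchoice ballI)
  then obtain st where st: "\<And>j a. j \<in> C \<Longrightarrow>
      path W (p j) (take a (\<rho> j)) (st a j) \<and> path W (st a j) (drop a (\<rho> j)) (q j)"
    using choice[of "\<lambda>a s. \<forall>j\<in>C. path W (p j) (take a (\<rho> j)) (s j) \<and> path W (s j) (drop a (\<rho> j)) (q j)"]
    by blast
  \<comment> \<open>Restriction to \<open>C\<close> makes joint states extensional functions, so
    that they can be counted, and equality of two of them means agreement on
    \<open>C\<close>.\<close>
  let ?f = "\<lambda>a. restrict (st a) C" and ?V = "C \<rightarrow>\<^sub>E states W"
  let ?K = "card C * card C"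
  have f: "?f a \<in> ?V" for a using st path_states_mem[OF W(1)] by (simp add: PiE_iff) metis
  have V: "finite ?V" "card ?V = card (states W) ^ card C"
    using C W(2) by (auto simp: card_PiE intro: finite_PiE)
  have "\<exists>s\<in>?V. Suc ?K ^ ?K < card {a \<in> {..l}. ?f a = s}"
  proof (rule ccontr)
    assume "\<not> ?thesis"
    then have le: "card {a \<in> {..l}. ?f a = s} \<le> Suc ?K ^ ?K" if "s \<in> ?V" for s
      using that by (meson not_le)
    have "{..l} = (\<Union>s\<in>?V. {a \<in> {..l}. ?f a = s})" using f by blast
    then have "Suc l = card (\<Union>s\<in>?V. {a \<in> {..l}. ?f a = s})" by (metis card_atMost)
    also have "\<dots> \<le> (\<Sum>s\<in>?V. card {a \<in> {..l}. ?f a = s})" using V(1) by (rule card_UN_le)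
    also have "\<dots> \<le> card ?V * Suc ?K ^ ?K"
      using sum_bounded_above[of ?V _ "Suc ?K ^ ?K"] le by simp
    finally show False using long V(2) by simp
  qed
  then obtain s where s: "Suc ?K ^ ?K < card {a \<in> {..l}. ?f a = s}" by blast
  define X where "X = {a \<in> {..l}. ?f a = s}"
  define D where "D = {d \<in> C \<times> C. weight G \<nu> (\<rho> (fst d)) \<noteq> weight G \<nu> (\<rho> (snd d))}"
  define R where "R = (\<lambda>(j, j') a b. a \<in> X \<and> b \<in> X \<and>
    weight G \<nu> (take a (\<rho> j) @ drop b (\<rho> j)) = weight G \<nu> (take a (\<rho> j') @ drop b (\<rho> j')))"
  have "card D \<le> ?K"
    unfolding D_def using C card_mono[of "C \<times> C" D] by (simp add: D_def card_cartesian_product)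
  then have "Suc (card D) ^ card D \<le> Suc ?K ^ ?K"
    by (intro order_trans[OF power_mono power_increasing]) auto
  then have big: "\<not> card X \<le> Suc (card D) ^ card D" using s by (simp add: X_def)
  have "\<exists>a b. a \<in> X \<and> b \<in> X \<and> a < b \<and> (\<forall>d\<in>D. \<not> R d a b)"
  proof (rule ccontr)
    assume no: "\<not> ?thesis"
    have "card X \<le> Suc (card D) ^ card D"
    proof (rule no_monochromatic_triangle_card[where R = R])
      show "finite D" "finite X" using C by (auto simp: D_def X_def)
      show "\<exists>d\<in>D. R d a b" if "a \<in> X" "b \<in> X" "a < b" for a b using no that by blast
      show "\<not> R d a c" if d: "d \<in> D" and abc: "a < b" "b < c" and R1: "R d a b" and R2: "R d b c"
        for d a b c
      proof
        assume R3: "R d a c"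
        obtain j j' where [simp]: "d = (j, j')" by fastforce
        \<comment> \<open>Cutting at \<open>a\<close>, \<open>b\<close>, \<open>c\<close> splits
          each run into four pieces; \<open>R1\<close>, \<open>R2\<close> and \<open>R3\<close> say
          that the outputs agree once the second piece, the third piece, or both are
          deleted.\<close>
        have split: "drop b (\<rho> i) = drop b (take c (\<rho> i)) @ drop c (\<rho> i)"
          "take b (\<rho> i) = take a (\<rho> i) @ drop a (take b (\<rho> i))" for i
          using append_take_drop_id[of "c - b" "drop b (\<rho> i)"]
            append_take_drop_id[of a "take b (\<rho> i)"] abc
          by (simp_all add: take_drop min_def)
        let ?x = "\<lambda>i. weight G \<nu> (take a (\<rho> i))" and ?y = "\<lambda>i. weight G \<nu> (drop a (take b (\<rho> i)))"
        let ?z = "\<lambda>i. weight G \<nu> (drop b (take c (\<rho> i)))" and ?w = "\<lambda>i. weight G \<nu> (drop c (\<rho> i))"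
        have sub: "weight G \<nu> (drop b (\<rho> i)) = ?z i \<otimes> ?w i"
          "weight G \<nu> (take b (\<rho> i)) = ?x i \<otimes> ?y i" for i
          unfolding weight_append[symmetric] split[symmetric] by (rule refl)+
        have w: "weight G \<nu> (\<rho> i) = ?x i \<otimes> (?y i \<otimes> (?z i \<otimes> ?w i))" for i
          using weight_append[of "take b (\<rho> i)" "drop b (\<rho> i)"]
          by (simp add: sub m_assoc weight_closed)
        have "weight G \<nu> (\<rho> j) = weight G \<nu> (\<rho> j')"
          unfolding w
          by (rule equal_excess_imp_equal)
             (use R1 R2 R3 in \<open>simp_all add: R_def sub weight_append weight_closed\<close>)
        then show False using d by (simp add: D_def)
      qed
    qed
    then show False using big by simp
  qed
  then obtain a b where ab: "a \<in> X" "b \<in> X" "a < b" "\<And>d. d \<in> D \<Longrightarrow> \<not> R d a b" by blast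
  show ?thesis
  proof
    show "a < b" "b \<le> l" using ab by (auto simp: X_def)
    fix j assume j: "j \<in> C"
    have "?f a = ?f b" using ab(1,2) by (simp add: X_def)
    from fun_cong[OF this, of j] have "st a j = st b j" using j by simp
    then show "path W (p j) (take a (\<rho> j) @ drop b (\<rho> j)) (q j)"
      using st[OF j] path_append[OF W(1)] by metis
    fix j' assume "j' \<in> C" "weight G \<nu> (\<rho> j) \<noteq> weight G \<nu> (\<rho> j')"
    then show "weight G \<nu> (take a (\<rho> j) @ drop b (\<rho> j)) \<noteq> weight G \<nu> (take a (\<rho> j') @ drop b (\<rho> j'))"
      using ab(4)[of "(j, j')"] ab(1,2) j by (auto simp: D_def R_def)
  qed
qed

text \<open>Repeated cutting, by induction on the common length of the runs. Only inequality of
  outputs has to survive: runs with equal outputs may end up with different ones.\<close>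

lemma joint_paths_short:
  assumes W: "transitions W \<subseteq> states W \<times> A \<times> D \<times> states W" "finite (states W)"
    and C: "finite C"
    and path: "\<And>j. j \<in> C \<Longrightarrow> path W (p j) (\<rho> j) (q j)"
    and word: "\<And>j j'. j \<in> C \<Longrightarrow> j' \<in> C \<Longrightarrow> word (\<rho> j) = word (\<rho> j')"
    and bound: "B \<ge> card (states W) ^ card C * Suc (card C * card C) ^ (card C * card C)"
  shows "\<exists>\<rho>'. \<forall>j\<in>C. path W (p j) (\<rho>' j) (q j) \<and> length (\<rho>' j) \<le> B \<and>
    (\<forall>j'\<in>C. word (\<rho>' j) = word (\<rho>' j') \<and>
      (weight G \<nu> (\<rho> j) \<noteq> weight G \<nu> (\<rho> j') \<longrightarrow> weight G \<nu> (\<rho>' j) \<noteq> weight G \<nu> (\<rho>' j')))"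
proof (cases "C = {}")
  case False
  have "\<exists>l. \<forall>j\<in>C. length (\<rho> j) = l"
  proof -
    obtain j0 where "j0 \<in> C" using False by blast
    then have "\<forall>j\<in>C. length (\<rho> j) = length (\<rho> j0)"
      using word unfolding word_def by (metis length_map)
    then show ?thesis ..
  qed
  then obtain l where "\<And>j. j \<in> C \<Longrightarrow> length (\<rho> j) = l" by blast
  then show ?thesis using path word
  proof (induction l arbitrary: \<rho> rule: less_induct)
    case (less l)
    show ?case
    proof (cases "l \<le> B")
      case True
      then have "length (\<rho> j) \<le> B" if "j \<in> C" for j using less.prems(1)[OF that] by simp
      then show ?thesis using less.prems(2,3) by (intro exI[of _ \<rho>]) blast
    next
      case False
      then have "l \<ge> card (states W) ^ card C * Suc (card C * card C) ^ (card C * card C)"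
        using bound by linarith
      from joint_paths_shrink[where p = p and q = q and \<rho> = \<rho>, OF W C less.prems(2,1) this]
      obtain a b where ab: "a < b" "b \<le> l"
        "\<And>j. j \<in> C \<Longrightarrow> path W (p j) (take a (\<rho> j) @ drop b (\<rho> j)) (q j)"
        "\<And>j j'. j \<in> C \<Longrightarrow> j' \<in> C \<Longrightarrow> weight G \<nu> (\<rho> j) \<noteq> weight G \<nu> (\<rho> j') \<Longrightarrow>
          weight G \<nu> (take a (\<rho> j) @ drop b (\<rho> j)) \<noteq> weight G \<nu> (take a (\<rho> j') @ drop b (\<rho> j'))"
        by blast
      \<comment> \<open>All runs are cut at the same positions, so their words stay equal.\<close>
      have wd: "word (take a (\<rho> j) @ drop b (\<rho> j)) = word (take a (\<rho> j') @ drop b (\<rho> j'))"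
        if "j \<in> C" "j' \<in> C" for j j'
        using less.prems(3)[OF that] by (simp add: word_def flip: take_map drop_map)
      have "l - (b - a) < l" using ab(1,2) by simp
      moreover have "length (take a (\<rho> j) @ drop b (\<rho> j)) = l - (b - a)" if "j \<in> C" for j
        using less.prems(1)[OF that] ab(1,2) by simp
      ultimately obtain \<rho>' where \<rho>': "\<forall>j\<in>C. path W (p j) (\<rho>' j) (q j) \<and> length (\<rho>' j) \<le> B \<and>
        (\<forall>j'\<in>C. word (\<rho>' j) = word (\<rho>' j') \<and>
          (weight G \<nu> (take a (\<rho> j) @ drop b (\<rho> j)) \<noteq> weight G \<nu> (take a (\<rho> j') @ drop b (\<rho> j')) \<longrightarrow>
            weight G \<nu> (\<rho>' j) \<noteq> weight G \<nu> (\<rho>' j')))"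
        using less.IH[of "l - (b - a)" "\<lambda>j. take a (\<rho> j) @ drop b (\<rho> j)", OF _ _ ab(3) wd] by blast
      then show ?thesis using ab(4) by (intro exI[of _ \<rho>']) blast
    qed
  qed
qed simp

end
end

section \<open>Counterexamples of bounded length\<close>

text \<open>Since \<open>\<nu>\<close> may identify names, a transition of the denoted automaton can
  have several preimages; one is chosen at each step.\<close>

lemma path_denoted_automaton:
  "path (denoted_automaton \<nu> W) p \<sigma> q \<longleftrightarrow>
    (\<exists>\<rho>. path W p \<rho> q \<and> \<sigma> = map (\<lambda>(p, a, c, q). (p, a, \<nu> c, q)) \<rho>)"
proof
  assume "path (denoted_automaton \<nu> W) p \<sigma> q"
  then show "\<exists>\<rho>. path W p \<rho> q \<and> \<sigma> = map (\<lambda>(p, a, c, q). (p, a, \<nu> c, q)) \<rho>"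
  proof (induction \<sigma> arbitrary: p)
    case Nil
    then show ?case by (auto simp: denoted_automaton_def)
  next
    case (Cons e \<sigma>)
    obtain p' a g r where e: "e = (p', a, g, r)" by (cases e)
    with Cons.prems obtain c where c: "(p, a, c, r) \<in> transitions W" "g = \<nu> c" "p' = p"
      by (auto simp: denoted_automaton_def)
    obtain \<rho> where "path W r \<rho> q" "\<sigma> = map (\<lambda>(p, a, c, q). (p, a, \<nu> c, q)) \<rho>"
      using Cons e by auto
    then show ?case using e c by (intro exI[of _ "(p, a, c, r) # \<rho>"]) simp
  qed
next
  have "path (denoted_automaton \<nu> W) p (map (\<lambda>(p, a, c, q). (p, a, \<nu> c, q)) \<rho>) q"
    if "path W p \<rho> q" for \<rho>
    using that by (induction \<rho> arbitrary: p) (force simp: denoted_automaton_def)+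
  then show "\<exists>\<rho>. path W p \<rho> q \<and> \<sigma> = map (\<lambda>(p, a, c, q). (p, a, \<nu> c, q)) \<rho> \<Longrightarrow>
      path (denoted_automaton \<nu> W) p \<sigma> q"
    by blast
qed

lemma run_denoted_automaton:
  "run G (denoted_automaton \<nu> W) p w \<alpha> q \<longleftrightarrow>
    (\<exists>\<rho>. path W p \<rho> q \<and> w = word \<rho> \<and> \<alpha> = weight G \<nu> \<rho>)"
  unfolding run_def path_denoted_automaton word_def weight_def
  by (auto simp: comp_def case_prod_unfold)

lemma initial_denoted_automaton: "initial (denoted_automaton \<nu> W) q \<longleftrightarrow> initial W q"
  by (force simp: initial_def denoted_automaton_def)

text \<open>A counterexample to the twinning property, restated for commutative groups. The \<open>j\<close>-th run is cut
  into \<open>2 * k\<close> legs from \<open>p t j\<close> to \<open>p (Suc t) j\<close>: the legs \<open>2 * i\<close> and \<open>2 * i + 1\<close> read the words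
  \<open>u\<close> and \<open>v\<close> with index \<open>i + 1\<close> in the twinning property, the latter being a loop.\<close>
definition separating_legs ::
    "('g, 'm) monoid_scheme \<Rightarrow> ('c \<Rightarrow> 'g) \<Rightarrow> ('q, 'a, 'c) wautomaton \<Rightarrow> nat \<Rightarrow>
      (nat \<Rightarrow> nat \<Rightarrow> 'q) \<Rightarrow> (nat \<Rightarrow> nat \<Rightarrow> ('q, 'a, 'c) transition list) \<Rightarrow> bool" where
  "separating_legs G \<nu> W k p \<tau> \<longleftrightarrow>
     (\<forall>j\<le>k. initial W (p 0 j)) \<and>
     (\<forall>t<2 * k. \<forall>j\<le>k. path W (p t j) (\<tau> t j) (p (Suc t) j)) \<and>
     (\<forall>i<k. \<forall>j\<le>k. p (2 * i + 1) j = p (2 * i + 2) j) \<and>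
     (\<forall>j\<le>k. \<forall>j'\<le>k. j \<noteq> j' \<longrightarrow> (\<exists>i<k.
        (\<forall>t<2 * i + 2. word (\<tau> t j) = word (\<tau> t j')) \<and>
        weight G \<nu> (\<tau> (2 * i + 1) j) \<noteq> weight G \<nu> (\<tau> (2 * i + 1) j')))"

text \<open>By commutativity the delay on the right is \<open>delay G x y\<close> times
  \<open>inv b \<otimes> c\<close>, and cancellation leaves \<open>b = c\<close>. The outputs
  accumulated before the loops thereby disappear from the twinning condition.\<close>

lemma (in comm_group) delay_eq_iff:
  assumes "x \<in> carrier G" "y \<in> carrier G" "b \<in> carrier G" "c \<in> carrier G"
  shows "delay G x y = delay G (x \<otimes> b) (y \<otimes> c) \<longleftrightarrow> b = c"
proof -
  have "delay G (x \<otimes> b) (y \<otimes> c) = delay G x y \<otimes> (inv b \<otimes> c)"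
    using assms by (simp add: delay_def inv_mult_group m_ac)
  moreover have "delay G x y \<otimes> (inv b \<otimes> c) = delay G x y \<longleftrightarrow> inv b \<otimes> c = \<one>"
    using assms by (intro l_cancel_one) (auto simp: delay_def)
  moreover have "inv b \<otimes> c = \<one> \<longleftrightarrow> b = c"
    using assms by (metis inv_solve_left' one_closed r_one)
  ultimately show ?thesis by auto
qed

context comm_group begin

context
  fixes \<nu> :: "nat \<Rightarrow> 'a" assumes \<nu>: "range \<nu> \<subseteq> carrier G"
begin

text \<open>By \<open>delay_eq_iff\<close>, a violation at index \<open>i\<close> means that the two
  loops there have different outputs. What remains is to regroup the runs on \<open>u\<close> and
  \<open>v\<close> as consecutive legs.\<close>

lemma not_branching_twinning_iff:
  "\<not> branching_twinning G (denoted_automaton \<nu> W) k \<longleftrightarrow> (\<exists>p \<tau>. separating_legs G \<nu> W k p \<tau>)"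
proof
  assume "\<not> branching_twinning G (denoted_automaton \<nu> W) k"
  note this[unfolded branching_twinning_def Let_def not_all not_imp]
  then obtain q \<gamma> u v \<alpha> \<beta> where
    init: "\<forall>j\<le>k. initial (denoted_automaton \<nu> W) (q 0 j) \<and>
        (q 0 j, \<gamma> j) \<in> t_init (denoted_automaton \<nu> W)" and
    runs: "\<forall>i\<in>{1..k}. \<forall>j\<le>k.
        run G (denoted_automaton \<nu> W) (q (i - 1) j) (u i j) (\<alpha> i j) (q i j) \<and>
        run G (denoted_automaton \<nu> W) (q i j) (v i j) (\<beta> i j) (q i j)" and
    sep: "\<not> (\<exists>j\<le>k. \<exists>j'\<le>k. j \<noteq> j' \<and> (\<forall>i\<in>{1..k}.
        (\<forall>i'\<in>{1..i}. u i' j = u i' j' \<and> v i' j = v i' j') \<longrightarrow>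
        delay G (\<gamma> j \<otimes> list_prod G (map (\<lambda>i'. \<alpha> i' j) [1..<Suc i]))
            (\<gamma> j' \<otimes> list_prod G (map (\<lambda>i'. \<alpha> i' j') [1..<Suc i])) =
          delay G (\<gamma> j \<otimes> list_prod G (map (\<lambda>i'. \<alpha> i' j) [1..<Suc i]) \<otimes> \<beta> i j)
            (\<gamma> j' \<otimes> list_prod G (map (\<lambda>i'. \<alpha> i' j') [1..<Suc i]) \<otimes> \<beta> i j')))"
    by (elim exE conjE) (rule that)
  let ?out = "\<lambda>i l. \<gamma> l \<otimes> list_prod G (map (\<lambda>i'. \<alpha> i' l) [1..<Suc i])"
  have "\<forall>i j. \<exists>\<rho>. i \<in> {1..k} \<longrightarrow> j \<le> k \<longrightarrow>
      path W (q (i - 1) j) \<rho> (q i j) \<and> u i j = word \<rho> \<and> \<alpha> i j = weight G \<nu> \<rho>"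
    using runs unfolding run_denoted_automaton by blast
  then obtain \<rho> where \<rho>: "\<And>i j. i \<in> {1..k} \<Longrightarrow> j \<le> k \<Longrightarrow>
      path W (q (i - 1) j) (\<rho> i j) (q i j) \<and> u i j = word (\<rho> i j) \<and> \<alpha> i j = weight G \<nu> (\<rho> i j)"
    by metis
  have "\<forall>i j. \<exists>\<sigma>. i \<in> {1..k} \<longrightarrow> j \<le> k \<longrightarrow>
      path W (q i j) \<sigma> (q i j) \<and> v i j = word \<sigma> \<and> \<beta> i j = weight G \<nu> \<sigma>"
    using runs unfolding run_denoted_automaton by blast
  then obtain \<sigma> where \<sigma>: "\<And>i j. i \<in> {1..k} \<Longrightarrow> j \<le> k \<Longrightarrow>
      path W (q i j) (\<sigma> i j) (q i j) \<and> v i j = word (\<sigma> i j) \<and> \<beta> i j = weight G \<nu> (\<sigma> i j)"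
    by metis
  \<comment> \<open>Leg \<open>2 * i\<close> leads to the loop state \<open>q (i + 1)\<close> and
    leg \<open>2 * i + 1\<close> stays there: boundaries 1 and 2 both give \<open>q 1\<close>,
    boundaries 3 and 4 give \<open>q 2\<close>.\<close>
  define p where "p = (\<lambda>t. q (Suc t div 2))"
  define \<tau> where "\<tau> = (\<lambda>t. if even t then \<rho> (Suc (t div 2)) else \<sigma> (Suc (t div 2)))"
  have "separating_legs G \<nu> W k p \<tau>"
    unfolding separating_legs_def
  proof (intro conjI allI impI)
    show "initial W (p 0 j)" if "j \<le> k" for j
      using init that initial_denoted_automaton[of \<nu> W "q 0 j"] by (simp add: p_def)
    show "path W (p t j) (\<tau> t j) (p (Suc t) j)" if t: "t < 2 * k" and j: "j \<le> k" for t j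
    proof -
      have i: "Suc (t div 2) \<in> {1..k}" using t by auto
      show ?thesis
        using \<rho>[OF i j] \<sigma>[OF i j] by (cases "even t") (auto simp: p_def \<tau>_def elim!: evenE oddE)
    qed
    show "p (2 * i + 1) j = p (2 * i + 2) j" for i j by (simp add: p_def)
    fix j j' assume jj: "j \<le> k" "j' \<le> k" "j \<noteq> j'"
    then obtain i where i: "i \<in> {1..k}"
      and eq: "\<And>i'. i' \<in> {1..i} \<Longrightarrow> u i' j = u i' j' \<and> v i' j = v i' j'"
      and ne: "delay G (?out i j) (?out i j') \<noteq> delay G (?out i j \<otimes> \<beta> i j) (?out i j' \<otimes> \<beta> i j')"
      using sep by blast
    have out: "?out i l \<in> carrier G" if "l \<le> k" for l
    proof (intro m_closed list_prod_closed)
      from init that have "(q 0 l, \<gamma> l) \<in> t_init (denoted_automaton \<nu> W)" by blast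
      then show "\<gamma> l \<in> carrier G" using \<nu> by (auto simp: denoted_automaton_def)
      show "set (map (\<lambda>i'. \<alpha> i' l) [1..<Suc i]) \<subseteq> carrier G"
        using \<rho> i that weight_closed[OF \<nu>] by (auto simp del: upt_Suc)
    qed
    have "\<beta> i j \<noteq> \<beta> i j'"
      using ne delay_eq_iff[OF out[OF jj(1)] out[OF jj(2)]] \<sigma>[OF i] jj weight_closed[OF \<nu>]
      by metis
    \<comment> \<open>Separating indices are counted from 0 and twinning indices from 1, whence
      \<open>i - 1\<close>.\<close>
    then have "weight G \<nu> (\<tau> (2 * (i - 1) + 1) j) \<noteq> weight G \<nu> (\<tau> (2 * (i - 1) + 1) j')"
      using \<sigma>[OF i] jj i by (simp add: \<tau>_def)
    moreover have "word (\<tau> t j) = word (\<tau> t j')" if "t < 2 * (i - 1) + 2" for t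
    proof -
      have t: "Suc (t div 2) \<in> {1..i}" "Suc (t div 2) \<in> {1..k}" using that i by auto
      show ?thesis using eq[OF t(1)] \<rho>[OF t(2)] \<sigma>[OF t(2)] jj by (simp add: \<tau>_def)
    qed
    ultimately show "\<exists>i<k. (\<forall>t<2 * i + 2. word (\<tau> t j) = word (\<tau> t j')) \<and>
        weight G \<nu> (\<tau> (2 * i + 1) j) \<noteq> weight G \<nu> (\<tau> (2 * i + 1) j')"
      using i by (intro exI[of _ "i - 1"]) auto
  qed
  then show "\<exists>p \<tau>. separating_legs G \<nu> W k p \<tau>" by blast
next
  assume "\<exists>p \<tau>. separating_legs G \<nu> W k p \<tau>"
  then obtain p \<tau> where legs: "separating_legs G \<nu> W k p \<tau>" by blast
  have init: "initial W (p 0 j)" if "j \<le> k" for j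
    using legs that unfolding separating_legs_def by blast
  have path: "path W (p t j) (\<tau> t j) (p (Suc t) j)" if "t < 2 * k" "j \<le> k" for t j
    using legs that unfolding separating_legs_def by blast
  have loop: "p (2 * i + 1) j = p (2 * i + 2) j" if "i < k" "j \<le> k" for i j
    using legs that unfolding separating_legs_def by blast
  have sep: "\<exists>i<k. (\<forall>t<2 * i + 2. word (\<tau> t j) = word (\<tau> t j')) \<and>
        weight G \<nu> (\<tau> (2 * i + 1) j) \<noteq> weight G \<nu> (\<tau> (2 * i + 1) j')"
    if "j \<le> k" "j' \<le> k" "j \<noteq> j'" for j j'
    using legs that unfolding separating_legs_def by blast
  \<comment> \<open>Separation concerns only words and loop outputs, so any initial weight of the
    starting state serves as \<open>\<gamma> j\<close>.\<close>
  have "\<forall>j. \<exists>g. j \<le> k \<longrightarrow> (p 0 j, g) \<in> t_init (denoted_automaton \<nu> W)"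
    using init initial_denoted_automaton[of \<nu> W] unfolding initial_def by blast
  then obtain \<gamma> where \<gamma>: "\<And>j. j \<le> k \<Longrightarrow> (p 0 j, \<gamma> j) \<in> t_init (denoted_automaton \<nu> W)"
    by metis
  \<comment> \<open>For \<open>i\<close> from 1 on, legs \<open>2 * i - 2\<close> and
    \<open>2 * i - 1\<close> become the two runs with index \<open>i\<close>; the fact
    \<open>loop\<close> identifies the end of the former with \<open>q i\<close>.\<close>
  define q where "q = (\<lambda>i. p (2 * i))"
  define \<rho> where "\<rho> = (\<lambda>i. \<tau> (2 * i - 2))"
  define \<sigma> where "\<sigma> = (\<lambda>i. \<tau> (2 * i - 1))"
  show "\<not> branching_twinning G (denoted_automaton \<nu> W) k"
  proof
    assume twin: "branching_twinning G (denoted_automaton \<nu> W) k"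
    let ?out = "\<lambda>i l. \<gamma> l \<otimes> list_prod G (map (\<lambda>i'. weight G \<nu> (\<rho> i' l)) [1..<Suc i])"
    have "\<exists>j\<le>k. \<exists>j'\<le>k. j \<noteq> j' \<and>
             (\<forall>i\<in>{1..k}.
                (\<forall>i'\<in>{1..i}. word (\<rho> i' j) = word (\<rho> i' j') \<and> word (\<sigma> i' j) = word (\<sigma> i' j')) \<longrightarrow>
                delay G (?out i j) (?out i j') =
                delay G (?out i j \<otimes> weight G \<nu> (\<sigma> i j)) (?out i j' \<otimes> weight G \<nu> (\<sigma> i j')))"
    proof (rule twin[unfolded branching_twinning_def Let_def, THEN spec[where x = q],
          THEN spec[where x = \<gamma>], THEN spec[where x = "\<lambda>i j. word (\<rho> i j)"],
          THEN spec[where x = "\<lambda>i j. word (\<sigma> i j)"], THEN spec[where x = "\<lambda>i j. weight G \<nu> (\<rho> i j)"],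
          THEN spec[where x = "\<lambda>i j. weight G \<nu> (\<sigma> i j)"], THEN mp], intro conjI allI impI ballI)
      fix j assume "j \<le> k"
      then show "initial (denoted_automaton \<nu> W) (q 0 j)"
        "(q 0 j, \<gamma> j) \<in> t_init (denoted_automaton \<nu> W)"
        using \<gamma>[of j] by (auto simp: q_def initial_def)
    next
      fix i j assume "i \<in> {1..k}" and j: "j \<le> k"
      then obtain m where m: "i = Suc m" "m < k" by (cases i) auto
      have "path W (q (i - 1) j) (\<rho> i j) (q i j)" "path W (q i j) (\<sigma> i j) (q i j)"
        using path[of "2 * m", OF _ j] path[of "2 * m + 1", OF _ j] loop[OF m(2) j] m
        by (auto simp: q_def \<rho>_def \<sigma>_def)
      then show "run G (denoted_automaton \<nu> W) (q (i - 1) j) (word (\<rho> i j)) (weight G \<nu> (\<rho> i j)) (q i j)"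
        "run G (denoted_automaton \<nu> W) (q i j) (word (\<sigma> i j)) (weight G \<nu> (\<sigma> i j)) (q i j)"
        unfolding run_denoted_automaton by blast+
    qed
    then obtain j j' where jj: "j \<le> k" "j' \<le> k" "j \<noteq> j'" and eq: "\<And>i. i \<in> {1..k} \<Longrightarrow>
        (\<And>i'. i' \<in> {1..i} \<Longrightarrow> word (\<rho> i' j) = word (\<rho> i' j') \<and> word (\<sigma> i' j) = word (\<sigma> i' j')) \<Longrightarrow>
        delay G (?out i j) (?out i j') =
        delay G (?out i j \<otimes> weight G \<nu> (\<sigma> i j)) (?out i j' \<otimes> weight G \<nu> (\<sigma> i j'))"
      by blast
    from sep[OF jj] obtain i where i: "i < k"
      and w: "\<And>t. t < 2 * i + 2 \<Longrightarrow> word (\<tau> t j) = word (\<tau> t j')"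
      and ne: "weight G \<nu> (\<tau> (2 * i + 1) j) \<noteq> weight G \<nu> (\<tau> (2 * i + 1) j')"
      by blast
    have out: "?out (Suc i) l \<in> carrier G" if "l \<le> k" for l
    proof (intro m_closed list_prod_closed)
      show "\<gamma> l \<in> carrier G" using \<gamma>[OF that] \<nu> by (auto simp: denoted_automaton_def)
      show "set (map (\<lambda>i'. weight G \<nu> (\<rho> i' l)) [1..<Suc (Suc i)]) \<subseteq> carrier G"
        using weight_closed[OF \<nu>] by auto
    qed
    have "weight G \<nu> (\<sigma> (Suc i) j) = weight G \<nu> (\<sigma> (Suc i) j')"
    proof (rule delay_eq_iff[THEN iffD1, OF out[OF jj(1)] out[OF jj(2)] _ _ eq])
      fix i' assume "i' \<in> {1..Suc i}"
      then show "word (\<rho> i' j) = word (\<rho> i' j') \<and> word (\<sigma> i' j) = word (\<sigma> i' j')"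
        unfolding \<rho>_def \<sigma>_def by (intro conjI w) auto
    qed (use i weight_closed[OF \<nu>] in auto)
    then show False using ne by (simp add: \<sigma>_def)
  qed
qed

text \<open>On each leg, the runs that have read the same words up to its end are shortened
  together, with the boundary states \<open>p\<close> fixed. Different groups can be treated
  independently, since a separated pair stays in one group through its separating loop. The bound is
  in terms of \<open>n\<close> because only an upper bound on the number of states will be computed
  from the input.\<close>

lemma separating_legs_short:
  assumes W: "transitions W \<subseteq> states W \<times> A \<times> D \<times> states W" "finite (states W)"
    and legs: "separating_legs G \<nu> W k p \<tau>"
    and n: "card (states W) \<le> n" "0 < n"
    and K: "K = Suc k * Suc k"
  shows "\<exists>\<tau>'. separating_legs G \<nu> W k p \<tau>' \<and>
    (\<forall>t<2 * k. \<forall>j\<le>k. length (\<tau>' t j) \<le> n ^ Suc k * Suc K ^ K)"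
proof -
  have path: "path W (p t j) (\<tau> t j) (p (Suc t) j)" if "t < 2 * k" "j \<le> k" for t j
    using legs that unfolding separating_legs_def by blast
  define C where "C = (\<lambda>t j. {j'. j' \<le> k \<and> (\<forall>t'\<le>t. word (\<tau> t' j') = word (\<tau> t' j))})"
  define good where "good = (\<lambda>t C \<rho>. \<forall>j\<in>C. path W (p t j) (\<rho> j) (p (Suc t) j) \<and>
    length (\<rho> j) \<le> n ^ Suc k * Suc K ^ K \<and> (\<forall>j'\<in>C. word (\<rho> j) = word (\<rho> j') \<and>
      (weight G \<nu> (\<tau> t j) \<noteq> weight G \<nu> (\<tau> t j') \<longrightarrow> weight G \<nu> (\<rho> j) \<noteq> weight G \<nu> (\<rho> j'))))"
  have ex: "\<exists>\<rho>. good t (C t j) \<rho>" if t: "t < 2 * k" for t j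
  proof -
    have C: "C t j \<subseteq> {..k}" by (auto simp: C_def)
    then have fin: "finite (C t j)" by (rule finite_subset) simp
    have card: "card (C t j) \<le> Suc k" using card_mono[OF _ C] by simp
    \<comment> \<open>Raising the exponent to \<open>Suc k\<close> is monotone because
      \<open>n\<close> is positive.\<close>
    have "card (states W) ^ card (C t j) \<le> n ^ Suc k"
      using n card by (intro order_trans[OF power_mono power_increasing]) auto
    moreover have "card (C t j) * card (C t j) \<le> K" unfolding K using card by (intro mult_mono) auto
    then have "Suc (card (C t j) * card (C t j)) ^ (card (C t j) * card (C t j)) \<le> Suc K ^ K"
      by (intro order_trans[OF power_mono power_increasing]) auto
    ultimately have bound: "card (states W) ^ card (C t j) *
        Suc (card (C t j) * card (C t j)) ^ (card (C t j) * card (C t j)) \<le> n ^ Suc k * Suc K ^ K"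
      by (rule mult_mono) auto
    show ?thesis unfolding good_def
    proof (rule joint_paths_short[OF \<nu> W fin _ _ bound])
      show "path W (p t j') (\<tau> t j') (p (Suc t) j')" if "j' \<in> C t j" for j'
        using path[OF t] that C by auto
      show "word (\<tau> t j1) = word (\<tau> t j2)" if "j1 \<in> C t j" "j2 \<in> C t j" for j1 j2
        using that by (simp add: C_def)
    qed
  qed
  \<comment> \<open>The choice depends on \<open>j\<close> only through the group
    \<open>C t j\<close>, so runs of one group take their paths from the same joint
    shortening.\<close>
  define \<tau>' where "\<tau>' = (\<lambda>t j. (SOME \<rho>. good t (C t j) \<rho>) j)"
  have good: "good t (C t j) (\<lambda>j'. (SOME \<rho>. good t (C t j) \<rho>) j')" if "t < 2 * k" for t j
    using someI_ex[OF ex[OF that]] by simp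
  have self: "j \<in> C t j" if "j \<le> k" for t j using that by (simp add: C_def)
  have "separating_legs G \<nu> W k p \<tau>'"
    unfolding separating_legs_def
  proof (intro conjI allI impI)
    show "initial W (p 0 j)" if "j \<le> k" for j
      using legs that unfolding separating_legs_def by blast
    show "path W (p t j) (\<tau>' t j) (p (Suc t) j)" if "t < 2 * k" "j \<le> k" for t j
      using good[OF that(1), of j] self[OF that(2), of t] unfolding good_def \<tau>'_def by blast
    show "p (2 * i + 1) j = p (2 * i + 2) j" if "i < k" "j \<le> k" for i j
      using legs that unfolding separating_legs_def by blast
    fix j j' assume jj: "j \<le> k" "j' \<le> k" "j \<noteq> j'"
    then obtain i where i: "i < k" and w: "\<And>t. t < 2 * i + 2 \<Longrightarrow> word (\<tau> t j) = word (\<tau> t j')"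
      and ne: "weight G \<nu> (\<tau> (2 * i + 1) j) \<noteq> weight G \<nu> (\<tau> (2 * i + 1) j')"
      using legs unfolding separating_legs_def by blast
    have C: "C t j = C t j'" if "t < 2 * i + 2" for t
      using w that by (auto simp: C_def)
    have *: "word (\<tau>' t j) = word (\<tau>' t j') \<and> (weight G \<nu> (\<tau> t j) \<noteq> weight G \<nu> (\<tau> t j') \<longrightarrow>
        weight G \<nu> (\<tau>' t j) \<noteq> weight G \<nu> (\<tau>' t j'))" if t: "t < 2 * i + 2" for t
    proof -
      have "t < 2 * k" using t i by simp
      from good[OF this, of j] show ?thesis
        using self[OF jj(1), of t] self[OF jj(2), of t]
        unfolding good_def \<tau>'_def C[OF t] by blast
    qed
    show "\<exists>i<k. (\<forall>t<2 * i + 2. word (\<tau>' t j) = word (\<tau>' t j')) \<and>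
        weight G \<nu> (\<tau>' (2 * i + 1) j) \<noteq> weight G \<nu> (\<tau>' (2 * i + 1) j')"
      using * i ne by (intro exI[of _ i]) simp
  qed
  moreover have "length (\<tau>' t j) \<le> n ^ Suc k * Suc K ^ K" if "t < 2 * k" "j \<le> k" for t j
    using good[OF that(1), of j] self[OF that(2), of t] unfolding good_def \<tau>'_def by blast
  ultimately show ?thesis by blast
qed

end
end

section \<open>Coding counterexamples by numbers\<close>

text \<open>The target of a transition and the source of the next are both read off
  \<open>x\<close>, so consecutive transitions fit by construction.\<close>

definition trace :: "(nat \<Rightarrow> 'q) \<Rightarrow> (nat \<Rightarrow> 'a) \<Rightarrow> (nat \<Rightarrow> 'c) \<Rightarrow> nat \<Rightarrow> ('q, 'a, 'c) transition list" where
  "trace x a c n = map (\<lambda>s. (x s, a s, c s, x (Suc s))) [0..<n]"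

lemma length_trace [simp]: "length (trace x a c n) = n"
  by (simp add: trace_def)

lemma word_trace: "word (trace x a c n) = map a [0..<n]"
  by (simp add: word_def trace_def comp_def)

lemma word_trace_eq_iff:
  "word (trace x a c n) = word (trace x' a' c' n') \<longleftrightarrow> n = n' \<and> (\<forall>s<n. a s = a' s)"
  by (auto simp: word_trace list_eq_iff_nth_eq)

lemma trace_case_nat:
  "trace (case_nat p x) (case_nat a' a) (case_nat c' c) (Suc n) = (p, a', c', x 0) # trace x a c n"
  by (simp add: trace_def upt_Suc_conv_map del: upt_Suc)

lemma path_imp_trace:
  assumes "transitions W \<subseteq> states W \<times> A \<times> C \<times> states W" "path W p \<rho> q"
  shows "\<exists>x a c. \<rho> = trace x a c (length \<rho>) \<and> x 0 = p \<and> x (length \<rho>) = q \<and> x 0 \<in> states W \<and>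
    (\<forall>s<length \<rho>. (x s, a s, c s, x (Suc s)) \<in> transitions W)"
  using assms(2)
proof (induction \<rho> arbitrary: p)
  case Nil
  then show ?case by (auto simp: trace_def)
next
  case (Cons e \<rho>)
  obtain a' c' r where e: "e = (p, a', c', r)" "(p, a', c', r) \<in> transitions W" "path W r \<rho> q"
    using Cons.prems by (cases e) auto
  from Cons.IH[OF e(3)] obtain x a c where x: "\<rho> = trace x a c (length \<rho>)" "x 0 = r"
    "x (length \<rho>) = q" "\<forall>s<length \<rho>. (x s, a s, c s, x (Suc s)) \<in> transitions W"
    by blast
  have "e # \<rho> = trace (case_nat p x) (case_nat a' a) (case_nat c' c) (length (e # \<rho>))"
    using x(2) e(1) by (simp add: trace_case_nat flip: x(1))
  moreover have "case_nat p x s \<in> states W" if "s = 0" for s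
    using that e(2) assms(1) by auto
  moreover have "(case_nat p x s, case_nat a' a s, case_nat c' c s, case_nat p x (Suc s)) \<in> transitions W"
    if "s < length (e # \<rho>)" for s
    using that x(2,4) e(2) by (auto split: nat.split simp: less_Suc_eq_0_disj)
  ultimately show ?case
    using x(3) by (intro exI[of _ "case_nat p x"] exI[of _ "case_nat a' a"] exI[of _ "case_nat c' c"]) simp
qed

lemma path_trace:
  assumes "transitions W \<subseteq> states W \<times> A \<times> C \<times> states W" "x 0 \<in> states W"
    and "\<forall>s<n. (x s, a s, c s, x (Suc s)) \<in> transitions W"
  shows "path W (x 0) (trace x a c n) (x n)"
  using assms(3)
proof (induction n)
  case (Suc n)
  have "path W (x n) [(x n, a n, c n, x (Suc n))] (x (Suc n))"
    using Suc.prems assms(1) by auto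
  with Suc show ?case
    unfolding trace_def by (auto simp: path_append[OF assms(1)])
qed (simp add: trace_def assms(2))

text \<open>Multiplying up names from the front gives a name of the output by primitive recursion
  from \<open>mul\<close>; the induction appends one transition at a time.\<close>

lemma (in comm_group) weight_trace:
  assumes "range \<nu> \<subseteq> carrier G" "\<nu> e = \<one>" "\<And>m n. \<nu> (mul m n) = \<nu> m \<otimes> \<nu> n"
  shows "weight G \<nu> (trace x a c n) = \<nu> (rec_nat e (\<lambda>s y. mul y (c s)) n)"
proof (induction n)
  case 0
  show ?case by (simp add: trace_def weight_def list_prod_def assms(2))
next
  case (Suc n)
  have "\<nu> (c n) \<in> carrier G" using assms(1) by auto
  then have "weight G \<nu> [(x n, a n, c n, x (Suc n))] = \<nu> (c n)"
    by (simp add: weight_def list_prod_def)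
  then show ?case using Suc by (simp add: trace_def weight_append[OF assms(1)] assms(3))
qed

text \<open>A function on triples of numbers is coded by the digits of one number \<open>c\<close> in base \<open>M\<close>.\<close>
definition table :: "nat \<Rightarrow> nat \<Rightarrow> nat \<Rightarrow> nat \<Rightarrow> nat \<Rightarrow> nat" where
  "table M c t j s = c div M ^ prod_encode (t, prod_encode (j, s)) mod M"

text \<open>Horner's scheme: the digit \<open>f 0\<close> is put below the number that codes the
  shifted function.\<close>

lemma digits_exist:
  assumes "\<forall>x<L. f x < M"
  shows "\<exists>c<M ^ L. \<forall>x<L. c div M ^ x mod M = (f x :: nat)"
  using assms
proof (induction L arbitrary: f)
  case (Suc L)
  then obtain c where c: "c < M ^ L" "\<forall>x<L. c div M ^ x mod M = f (Suc x)"
    by (auto dest!: meta_spec[of _ "\<lambda>x. f (Suc x)"])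
  have f0: "f 0 < M" using Suc.prems by simp
  have "f 0 + M * c < M ^ Suc L"
  proof -
    have "f 0 + M * c < M * Suc c" using f0 by simp
    also have "\<dots> \<le> M * M ^ L" using c(1) by (intro mult_le_mono2) simp
    finally show ?thesis by simp
  qed
  moreover have "(f 0 + M * c) div M ^ x mod M = f x" if "x < Suc L" for x
  proof (cases x)
    case 0
    then show ?thesis using f0 by simp
  next
    case (Suc y)
    have "(f 0 + M * c) div M = c" using f0 by simp
    then show ?thesis using Suc c(2) that by (simp add: div_mult2_eq)
  qed
  ultimately show ?case by blast
qed simp

text \<open>Serves to bound the index of every table entry by that of the largest arguments.\<close>

lemma prod_encode_mono: "a \<le> a' \<Longrightarrow> b \<le> b' \<Longrightarrow> prod_encode (a, b) \<le> prod_encode (a', b')"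
proof -
  assume *: "a \<le> a'" "b \<le> b'"
  have "triangle m \<le> triangle n" if "m \<le> n" for m n
    using that unfolding triangle_def by (intro div_le_mono mult_le_mono) auto
  then show ?thesis using * by (simp add: prod_encode_def add_mono)
qed

lemma table_exists:
  assumes "0 < M" "L = Suc (prod_encode (t0, prod_encode (j0, s0)))"
  obtains c where "c < M ^ L"
    "\<And>t j s. t \<le> t0 \<Longrightarrow> j \<le> j0 \<Longrightarrow> s \<le> s0 \<Longrightarrow> f t j s < M \<Longrightarrow> table M c t j s = f t j s"
proof -
  \<comment> \<open>Reduction modulo \<open>M\<close> makes every value a digit; agreement with
    \<open>f\<close> is claimed only where \<open>f\<close> is already below
    \<open>M\<close>.\<close>
  define g where "g = (\<lambda>x. (case prod_decode x of (t, y) \<Rightarrow> case prod_decode y of (j, s) \<Rightarrow> f t j s) mod M)"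
  have "\<forall>x<L. g x < M" using assms(1) by (simp add: g_def)
  from digits_exist[OF this] obtain c where c: "c < M ^ L" "\<forall>x<L. c div M ^ x mod M = g x" by blast
  show ?thesis
  proof (rule that[OF c(1)])
    fix t j s assume "t \<le> t0" "j \<le> j0" "s \<le> s0" and f: "f t j s < M"
    then have "prod_encode (t, prod_encode (j, s)) < L"
      unfolding assms(2) less_Suc_eq_le by (intro prod_encode_mono)
    then show "table M c t j s = f t j s" using c(2) f by (simp add: table_def g_def)
  qed
qed

text \<open>Separating legs over input codes: leg \<open>t\<close> of run \<open>j\<close> has length \<open>l t j\<close>, and its \<open>s\<close>-th transition is
  \<open>(x t j s, a t j s, c t j s, x t j (Suc s))\<close>. Lengths, states, letters and weights are thus four
  functions on bounded arguments, which can be searched for as tables.\<close>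
definition coded_legs ::
    "(nat \<Rightarrow> 'g) \<Rightarrow> (nat \<Rightarrow> nat \<Rightarrow> nat) \<Rightarrow> nat \<Rightarrow> nat \<Rightarrow> nat \<Rightarrow> nat \<Rightarrow> nat \<Rightarrow>
      (nat \<Rightarrow> nat \<Rightarrow> nat) \<Rightarrow> (nat \<Rightarrow> nat \<Rightarrow> nat \<Rightarrow> nat) \<Rightarrow> (nat \<Rightarrow> nat \<Rightarrow> nat \<Rightarrow> nat) \<Rightarrow>
      (nat \<Rightarrow> nat \<Rightarrow> nat \<Rightarrow> nat) \<Rightarrow> bool" where
  "coded_legs \<nu> mul e S I T k l x a c \<longleftrightarrow>
     (\<forall>j<Suc k. \<exists>g<I. prod_encode (x 0 j 0, g) \<in> set_decode I) \<and>
     (\<forall>t<2 * k. \<forall>j<Suc k. x t j 0 \<in> set_decode S \<and> x t j (l t j) = x (Suc t) j 0 \<and>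
        (\<forall>s<l t j. prod_encode (x t j s, prod_encode (a t j s, prod_encode (c t j s, x t j (Suc s))))
           \<in> set_decode T)) \<and>
     (\<forall>i<k. \<forall>j<Suc k. x (2 * i + 1) j 0 = x (2 * i + 2) j 0) \<and>
     (\<forall>j<Suc k. \<forall>j'<Suc k. \<not> j = j' \<longrightarrow> (\<exists>i<k.
        (\<forall>t<2 * i + 2. l t j = l t j' \<and> (\<forall>s<l t j. a t j s = a t j' s)) \<and>
        \<not> \<nu> (rec_nat e (\<lambda>s y. mul y (c (2 * i + 1) j s)) (l (2 * i + 1) j)) =
          \<nu> (rec_nat e (\<lambda>s y. mul y (c (2 * i + 1) j' s)) (l (2 * i + 1) j'))))"

text \<open>A member \<open>x\<close> contributes \<open>2 ^ x\<close>, which exceeds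
  \<open>x\<close>. This bounds the states, letters and names that occur by the codes in the
  input.\<close>

lemma set_decode_less: "x \<in> set_decode S \<Longrightarrow> x < S"
proof -
  assume "x \<in> set_decode S"
  then have "2 ^ x \<le> S" unfolding set_decode_def
    by (metis div_less even_zero mem_Collect_eq not_le)
  then show ?thesis using less_exp[of x] by linarith
qed

section \<open>Passing between separating legs and bounded tables\<close>

lemma (in comm_group) separating_legs_imp_coded:
  fixes \<nu> :: "nat \<Rightarrow> 'a"
  assumes \<nu>: "range \<nu> \<subseteq> carrier G" "\<nu> e = \<one>" "\<And>m n. \<nu> (mul m n) = \<nu> m \<otimes> \<nu> n"
    and W: "weighted_automaton UNIV A W"
    and legs: "separating_legs G \<nu> W k p \<tau>"
  shows "\<exists>x a c. coded_legs \<nu> mul e (set_encode (states W)) (set_encode (prod_encode ` t_init W))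
    (set_encode (transition_encode ` transitions W)) k (\<lambda>t j. length (\<tau> t j)) x a c"
proof -
  have T: "transitions W \<subseteq> states W \<times> A \<times> UNIV \<times> states W"
    and fin: "finite (states W)" "finite (t_init W)" "finite (transitions W)"
    using W by (auto simp: weighted_automaton_def)
  have "\<forall>t j. \<exists>x a c. t < 2 * k \<longrightarrow> j \<le> k \<longrightarrow> \<tau> t j = trace x a c (length (\<tau> t j)) \<and> x 0 = p t j \<and>
      x (length (\<tau> t j)) = p (Suc t) j \<and> x 0 \<in> states W \<and>
      (\<forall>s<length (\<tau> t j). (x s, a s, c s, x (Suc s)) \<in> transitions W)"
    using legs path_imp_trace[OF T] unfolding separating_legs_def by meson
  then obtain X a c where X: "\<And>t j. t < 2 * k \<Longrightarrow> j \<le> k \<Longrightarrow>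
      \<tau> t j = trace (X t j) (a t j) (c t j) (length (\<tau> t j)) \<and> X t j 0 = p t j \<and>
      X t j (length (\<tau> t j)) = p (Suc t) j \<and> X t j 0 \<in> states W \<and>
      (\<forall>s<length (\<tau> t j). (X t j s, a t j s, c t j s, X t j (Suc s)) \<in> transitions W)"
    by metis
  \<comment> \<open>\<open>X t\<close> describes leg \<open>t\<close> and is known only for
    \<open>t < 2 * k\<close>; at the final boundary, where no leg starts, the state is supplied by a
    constant sequence.\<close>
  define x where "x = (\<lambda>t. if t < 2 * k then X t else (\<lambda>j s. p t j))"
  have x0: "x t j 0 = p t j" if "j \<le> k" for t j using X that by (simp add: x_def)
  have x: "x t = X t" if "t < 2 * k" for t using that by (simp add: x_def)
  have "coded_legs \<nu> mul e (set_encode (states W)) (set_encode (prod_encode ` t_init W))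
    (set_encode (transition_encode ` transitions W)) k (\<lambda>t j. length (\<tau> t j)) x a c"
    unfolding coded_legs_def
  proof (intro conjI allI impI; (unfold less_Suc_eq_le)?)
    show "\<exists>g<set_encode (prod_encode ` t_init W).
        prod_encode (x 0 j 0, g) \<in> set_decode (set_encode (prod_encode ` t_init W))" if "j \<le> k" for j
    proof -
      obtain g where "(p 0 j, g) \<in> t_init W"
        using legs \<open>j \<le> k\<close> unfolding separating_legs_def initial_def by blast
      then have *: "prod_encode (p 0 j, g) \<in> set_decode (set_encode (prod_encode ` t_init W))"
        using fin by simp
      \<comment> \<open>The name \<open>g\<close> is at most the code of its pair, which lies below
        the code of the set; hence a bounded search finds \<open>g\<close>.\<close>
      then show ?thesis
        using set_decode_less[OF *] le_prod_encode_2[of g "p 0 j"] x0[OF \<open>j \<le> k\<close>]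
        by (intro exI[of _ g]) simp
    qed
    fix t j assume t: "t < 2 * k" and j: "j \<le> k"
    show "x t j 0 \<in> set_decode (set_encode (states W))" "x t j (length (\<tau> t j)) = x (Suc t) j 0"
      using X[OF t j] fin x0[OF j, symmetric] x[OF t] by auto
    fix s assume "s < length (\<tau> t j)"
    then have "(x t j s, a t j s, c t j s, x t j (Suc s)) \<in> transitions W"
      using X[OF t j] x[OF t] by simp
    then have "transition_encode (x t j s, a t j s, c t j s, x t j (Suc s))
        \<in> set_decode (set_encode (transition_encode ` transitions W))"
      using fin by (simp del: transition_encode.simps)
    then show "prod_encode (x t j s, prod_encode (a t j s, prod_encode (c t j s, x t j (Suc s))))
        \<in> set_decode (set_encode (transition_encode ` transitions W))"
      by simp
  next
    show "x (2 * i + 1) j 0 = x (2 * i + 2) j 0" if "i < k" "j \<le> k" for i j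
      using legs that unfolding separating_legs_def x0[OF that(2)] by blast
  next
    fix j j' assume jj: "j \<le> k" "j' \<le> k" "\<not> j = j'"
    then obtain i where i: "i < k" and w: "\<And>t. t < 2 * i + 2 \<Longrightarrow> word (\<tau> t j) = word (\<tau> t j')"
      and ne: "weight G \<nu> (\<tau> (2 * i + 1) j) \<noteq> weight G \<nu> (\<tau> (2 * i + 1) j')"
      using legs unfolding separating_legs_def by blast
    have "length (\<tau> t j) = length (\<tau> t j') \<and> (\<forall>s<length (\<tau> t j). a t j s = a t j' s)"
      if "t < 2 * i + 2" for t
    proof -
      have t: "t < 2 * k" using that i by simp
      have "\<tau> t j = trace (X t j) (a t j) (c t j) (length (\<tau> t j))"
        "\<tau> t j' = trace (X t j') (a t j') (c t j') (length (\<tau> t j'))"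
        using X[OF t jj(1)] X[OF t jj(2)] by blast+
      then show ?thesis using w[OF that] word_trace_eq_iff by metis
    qed
    moreover have "weight G \<nu> (\<tau> (2 * i + 1) l) =
        \<nu> (rec_nat e (\<lambda>s y. mul y (c (2 * i + 1) l s)) (length (\<tau> (2 * i + 1) l)))" if "l \<le> k" for l
    proof -
      have "2 * i + 1 < 2 * k" using i by simp
      from X[OF this that]
      have "\<tau> (2 * i + 1) l = trace (X (2 * i + 1) l) (a (2 * i + 1) l) (c (2 * i + 1) l)
          (length (\<tau> (2 * i + 1) l))" ..
      then show ?thesis by (rule ssubst[of _ _ "\<lambda>\<sigma>. weight G \<nu> \<sigma> = _"]) (rule weight_trace[OF \<nu>])
    qed
    ultimately show "\<exists>i<k. (\<forall>t<2 * i + 2. length (\<tau> t j) = length (\<tau> t j') \<and>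
          (\<forall>s<length (\<tau> t j). a t j s = a t j' s)) \<and>
        \<not> \<nu> (rec_nat e (\<lambda>s y. mul y (c (2 * i + 1) j s)) (length (\<tau> (2 * i + 1) j))) =
          \<nu> (rec_nat e (\<lambda>s y. mul y (c (2 * i + 1) j' s)) (length (\<tau> (2 * i + 1) j')))"
      using ne i jj by metis
  qed
  then show ?thesis by blast
qed

lemma (in comm_group) coded_imp_separating_legs:
  fixes \<nu> :: "nat \<Rightarrow> 'a"
  assumes \<nu>: "range \<nu> \<subseteq> carrier G" "\<nu> e = \<one>" "\<And>m n. \<nu> (mul m n) = \<nu> m \<otimes> \<nu> n"
    and W: "weighted_automaton UNIV A W"
    and coded: "coded_legs \<nu> mul e (set_encode (states W)) (set_encode (prod_encode ` t_init W))
      (set_encode (transition_encode ` transitions W)) k l x a c"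
  shows "separating_legs G \<nu> W k (\<lambda>t j. x t j 0) (\<lambda>t j. trace (x t j) (a t j) (c t j) (l t j))"
  unfolding separating_legs_def
proof (intro conjI allI impI)
  have T: "transitions W \<subseteq> states W \<times> A \<times> UNIV \<times> states W"
    and fin: "finite (states W)" "finite (t_init W)" "finite (transitions W)"
    using W by (auto simp: weighted_automaton_def)
  show "initial W (x 0 j 0)" if "j \<le> k" for j
  proof -
    have "\<exists>g. prod_encode (x 0 j 0, g) \<in> set_decode (set_encode (prod_encode ` t_init W))"
      using coded that unfolding coded_legs_def by (meson less_Suc_eq_le)
    then show ?thesis using fin by (auto simp: initial_def)
  qed
  show "path W (x t j 0) (trace (x t j) (a t j) (c t j) (l t j)) (x (Suc t) j 0)"
    if t: "t < 2 * k" and j: "j \<le> k" for t j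
  proof -
    have *: "x t j 0 \<in> set_decode (set_encode (states W)) \<and> x t j (l t j) = x (Suc t) j 0 \<and>
        (\<forall>s<l t j. transition_encode (x t j s, a t j s, c t j s, x t j (Suc s))
           \<in> set_decode (set_encode (transition_encode ` transitions W)))"
      using coded t j unfolding coded_legs_def transition_encode.simps by (meson less_Suc_eq_le)
    then have "\<forall>s<l t j. (x t j s, a t j s, c t j s, x t j (Suc s)) \<in> transitions W"
      using fin by (simp add: inj_image_mem_iff[OF inj_transition_encode] del: transition_encode.simps)
    moreover have "x t j 0 \<in> states W" using * fin by simp
    ultimately show ?thesis using path_trace[OF T, of "x t j"] * by metis
  qed
  show "x (2 * i + 1) j 0 = x (2 * i + 2) j 0" if "i < k" "j \<le> k" for i j
    using coded that unfolding coded_legs_def by (meson less_Suc_eq_le)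
  fix j j' assume "j \<le> k" "j' \<le> k" "j \<noteq> j'"
  then show "\<exists>i<k. (\<forall>t<2 * i + 2. word (trace (x t j) (a t j) (c t j) (l t j)) =
        word (trace (x t j') (a t j') (c t j') (l t j'))) \<and>
      weight G \<nu> (trace (x (2 * i + 1) j) (a (2 * i + 1) j) (c (2 * i + 1) j) (l (2 * i + 1) j)) \<noteq>
      weight G \<nu> (trace (x (2 * i + 1) j') (a (2 * i + 1) j') (c (2 * i + 1) j') (l (2 * i + 1) j'))"
    using coded unfolding coded_legs_def word_trace_eq_iff weight_trace[OF \<nu>] by (meson less_Suc_eq_le)
qed

text \<open>Needed because a table agrees with a given function only on a bounded range. Letters and
  names are read before the end of a leg, states up to its end, and at the final boundary only
  position 0, which \<open>x0\<close> covers.\<close>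

lemma coded_legs_cong:
  assumes coded: "coded_legs \<nu> mul e S I T k l x a c"
    and l: "\<And>t j. t < 2 * k \<Longrightarrow> j \<le> k \<Longrightarrow> l' t j = l t j"
    and x: "\<And>t j s. t < 2 * k \<Longrightarrow> j \<le> k \<Longrightarrow> s \<le> l t j \<Longrightarrow> x' t j s = x t j s"
    and x0: "\<And>t j. t \<le> 2 * k \<Longrightarrow> j \<le> k \<Longrightarrow> x' t j 0 = x t j 0"
    and a: "\<And>t j s. t < 2 * k \<Longrightarrow> j \<le> k \<Longrightarrow> s < l t j \<Longrightarrow> a' t j s = a t j s"
    and c: "\<And>t j s. t < 2 * k \<Longrightarrow> j \<le> k \<Longrightarrow> s < l t j \<Longrightarrow> c' t j s = c t j s"
  shows "coded_legs \<nu> mul e S I T k l' x' a' c'"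
proof -
  have rec: "rec_nat e (\<lambda>s y. mul y (c' t j s)) (l' t j) = rec_nat e (\<lambda>s y. mul y (c t j s)) (l t j)"
    if "t < 2 * k" "j \<le> k" for t j
  proof -
    have "rec_nat e (\<lambda>s y. mul y (c' t j s)) n = rec_nat e (\<lambda>s y. mul y (c t j s)) n" if "n \<le> l t j" for n
      using that by (induction n) (use c[OF \<open>t < 2 * k\<close> \<open>j \<le> k\<close>] in auto)
    then show ?thesis using l[OF that] by simp
  qed
  show ?thesis
    unfolding coded_legs_def
  proof (intro conjI allI impI; (unfold less_Suc_eq_le)?)
    show "\<exists>g<I. prod_encode (x' 0 j 0, g) \<in> set_decode I" if "j \<le> k" for j
      using coded that x0[of 0 j] unfolding coded_legs_def by (simp add: less_Suc_eq_le)
    fix t j assume t: "t < 2 * k" and j: "j \<le> k"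
    have *: "x t j 0 \<in> set_decode S \<and> x t j (l t j) = x (Suc t) j 0 \<and>
        (\<forall>s<l t j. prod_encode (x t j s, prod_encode (a t j s, prod_encode (c t j s, x t j (Suc s))))
           \<in> set_decode T)"
      using coded t j unfolding coded_legs_def by (meson less_Suc_eq_le)
    show "x' t j 0 \<in> set_decode S" "x' t j (l' t j) = x' (Suc t) j 0"
      using * x0[of _ j] x[OF t j] l[OF t j] t j by simp_all
    show "prod_encode (x' t j s, prod_encode (a' t j s, prod_encode (c' t j s, x' t j (Suc s))))
        \<in> set_decode T" if "s < l' t j" for s
      using * x[OF t j] a[OF t j] c[OF t j] l[OF t j] that by simp
  next
    show "x' (2 * i + 1) j 0 = x' (2 * i + 2) j 0" if "i < k" "j \<le> k" for i j
    proof -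
      have "x (2 * i + 1) j 0 = x (2 * i + 2) j 0"
        using coded that unfolding coded_legs_def by (meson less_Suc_eq_le)
      then show ?thesis using x0[of "2 * i + 1" j] x0[of "2 * i + 2" j] that by simp
    qed
  next
    fix j j' assume jj: "j \<le> k" "j' \<le> k" "\<not> j = j'"
    then obtain i where i: "i < k"
      and w: "\<And>t. t < 2 * i + 2 \<Longrightarrow> l t j = l t j' \<and> (\<forall>s<l t j. a t j s = a t j' s)"
      and ne: "\<not> \<nu> (rec_nat e (\<lambda>s y. mul y (c (2 * i + 1) j s)) (l (2 * i + 1) j)) =
        \<nu> (rec_nat e (\<lambda>s y. mul y (c (2 * i + 1) j' s)) (l (2 * i + 1) j'))"
      using coded unfolding coded_legs_def by (meson less_Suc_eq_le)
    have "l' t j = l' t j' \<and> (\<forall>s<l' t j. a' t j s = a' t j' s)" if "t < 2 * i + 2" for t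
    proof -
      have t: "t < 2 * k" using that i by simp
      show ?thesis
        using w[OF that] l[OF t jj(1)] l[OF t jj(2)] a[OF t jj(1)] a[OF t jj(2)] by simp
    qed
    moreover have t: "2 * i + 1 < 2 * k" using i by simp
    ultimately show "\<exists>i<k. (\<forall>t<2 * i + 2. l' t j = l' t j' \<and> (\<forall>s<l' t j. a' t j s = a' t j' s)) \<and>
        \<not> \<nu> (rec_nat e (\<lambda>s y. mul y (c' (2 * i + 1) j s)) (l' (2 * i + 1) j)) =
          \<nu> (rec_nat e (\<lambda>s y. mul y (c' (2 * i + 1) j' s)) (l' (2 * i + 1) j'))"
      using ne i rec[OF t jj(1)] rec[OF t jj(2)] by (intro exI[of _ i]) simp
  qed
qed

text \<open>Every value consulted is below the base \<open>M\<close>: lengths because of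
  \<open>B\<close>, the others by \<open>set_decode_less\<close>. The number \<open>L\<close> of
  digits reaches past the index of the largest arguments.\<close>

lemma coded_legs_tables:
  assumes coded: "coded_legs \<nu> mul e S I T k l x a c"
    and l: "\<And>t j. t < 2 * k \<Longrightarrow> j \<le> k \<Longrightarrow> l t j \<le> B"
    and M: "M = Suc (S + I + T + B)"
    and L: "L = Suc (prod_encode (2 * k, prod_encode (k, B)))"
  shows "\<exists>cl<M ^ L. \<exists>cx<M ^ L. \<exists>ca<M ^ L. \<exists>cc<M ^ L.
    coded_legs \<nu> mul e S I T k (\<lambda>t j. table M cl t j 0) (table M cx) (table M ca) (table M cc)"
proof -
  have "0 < M" using M by simp
  note tab = table_exists[OF this L]
  obtain cl where cl: "cl < M ^ L" "\<And>t j s. t \<le> 2 * k \<Longrightarrow> j \<le> k \<Longrightarrow> s \<le> B \<Longrightarrow> l t j < M \<Longrightarrow>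
      table M cl t j s = l t j" using tab[of "\<lambda>t j s. l t j"] by blast
  obtain cx where cx: "cx < M ^ L" "\<And>t j s. t \<le> 2 * k \<Longrightarrow> j \<le> k \<Longrightarrow> s \<le> B \<Longrightarrow> x t j s < M \<Longrightarrow>
      table M cx t j s = x t j s" using tab[of x] by blast
  obtain ca where ca: "ca < M ^ L" "\<And>t j s. t \<le> 2 * k \<Longrightarrow> j \<le> k \<Longrightarrow> s \<le> B \<Longrightarrow> a t j s < M \<Longrightarrow>
      table M ca t j s = a t j s" using tab[of a] by blast
  obtain cc where cc: "cc < M ^ L" "\<And>t j s. t \<le> 2 * k \<Longrightarrow> j \<le> k \<Longrightarrow> s \<le> B \<Longrightarrow> c t j s < M \<Longrightarrow>
      table M cc t j s = c t j s" using tab[of c] by blast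
  have small: "x t j 0 < S" "x t j (l t j) = x (Suc t) j 0"
      "s < l t j \<Longrightarrow> a t j s < T \<and> c t j s < T \<and> x t j (Suc s) < T"
    if "t < 2 * k" "j \<le> k" for t j s
  proof -
    have *: "x t j 0 \<in> set_decode S" "x t j (l t j) = x (Suc t) j 0"
      "\<And>s. s < l t j \<Longrightarrow> prod_encode (x t j s, prod_encode (a t j s, prod_encode (c t j s, x t j (Suc s))))
           \<in> set_decode T"
      using coded that unfolding coded_legs_def by (meson less_Suc_eq_le)+
    show "x t j 0 < S" "x t j (l t j) = x (Suc t) j 0"
      using *(1,2) by (auto intro: set_decode_less)
    assume "s < l t j"
    from set_decode_less[OF *(3)[OF this]]
    show "a t j s < T \<and> c t j s < T \<and> x t j (Suc s) < T"
      by (meson le_prod_encode_1 le_prod_encode_2 le_less_trans)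
  qed
  \<comment> \<open>The first state of a leg is bounded by \<open>S\<close>, each later one by
    \<open>T\<close> as the target of the preceding transition.\<close>
  have xM: "x t j s < M" if "t < 2 * k" "j \<le> k" "s \<le> l t j" for t j s
    using small(1)[OF that(1,2)] small(3)[OF that(1,2), of "s - 1"] that(3) M by (cases s) auto
  have x0M: "x t j 0 < M" if t: "t \<le> 2 * k" and j: "j \<le> k" for t j
  proof (cases t)
    \<comment> \<open>For \<open>k = 0\<close> no leg starts at boundary 0, so the bound is taken
      from the code \<open>I\<close> of the initial pairs.\<close>
    case 0
    obtain g where "prod_encode (x 0 j 0, g) \<in> set_decode I"
      using coded j unfolding coded_legs_def by (meson less_Suc_eq_le)
    from set_decode_less[OF this] le_prod_encode_1[of "x 0 j 0" g] show ?thesis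
      using 0 M by simp
  next
    case (Suc t')
    then show ?thesis using small(2)[of t' j] xM[of t' j "l t' j"] t j by simp
  qed
  have "coded_legs \<nu> mul e S I T k (\<lambda>t j. table M cl t j 0) (table M cx) (table M ca) (table M cc)"
  proof (rule coded_legs_cong[OF coded])
    fix t j assume tj: "t < 2 * k" "j \<le> k"
    show "table M cl t j 0 = l t j" using cl(2)[of t j 0] l[OF tj] tj M by simp
    show "table M cx t j s = x t j s" if "s \<le> l t j" for s
      using cx(2)[of t j s] l[OF tj] xM[OF tj that] tj that by simp
    show "table M ca t j s = a t j s" "table M cc t j s = c t j s" if "s < l t j" for s
      using ca(2)[of t j s] cc(2)[of t j s] small(3)[OF tj that] l[OF tj] tj that M by simp_all
  next
    show "table M cx t j 0 = x t j 0" if "t \<le> 2 * k" "j \<le> k" for t j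
      using cx(2)[of t j 0] x0M[OF that] that by simp
  qed
  then show ?thesis using cl(1) cx(1) ca(1) cc(1) by blast
qed

section \<open>The decision procedure\<close>

lemma computable_table:
  "computable_fun n M \<Longrightarrow> computable_fun n c \<Longrightarrow> computable_fun n t \<Longrightarrow> computable_fun n j \<Longrightarrow> computable_fun n s \<Longrightarrow>
    computable_fun n (\<lambda>e. table (M e) (c e) (t e) (j e) (s e))"
  unfolding table_def by (intro computable_intros)

theorem theorem4:
  fixes G :: "('g, 'm) monoid_scheme" and \<nu> :: "nat \<Rightarrow> 'g"
  assumes "comm_group G"
    and "computable_numbering G \<nu>"
  shows "decidable_problem input_encode (trimmed_inputs \<nu>)
           (\<lambda>(A, W, k). branching_twinning G (denoted_automaton \<nu> W) k)"
proof -
  interpret comm_group G by fact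
  have range: "range \<nu> = carrier G"
    and mul: "\<exists>r. \<forall>m n. \<exists>l. computes r [m, n] l \<and> \<nu> l = \<nu> m \<otimes>\<^bsub>G\<^esub> \<nu> n"
    and eq: "\<exists>r. \<forall>x\<in>UNIV. computes r (case x of (m, n) \<Rightarrow> [m, n])
        (if (case x of (m, n) \<Rightarrow> \<nu> m = \<nu> n) then 1 else 0)"
    using assms(2) unfolding computable_numbering_def decidable_problem_def by blast+
  \<comment> \<open>A name of the neutral element exists and enters the program as a constant, so no
    algorithm has to find it.\<close>
  obtain one where one: "\<nu> one = \<one>\<^bsub>G\<^esub>" using range one_closed by (metis imageE)
  obtain rm where "\<forall>m n. \<exists>l. computes rm [m, n] l \<and> \<nu> l = \<nu> m \<otimes>\<^bsub>G\<^esub> \<nu> n"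
    using mul by blast
  then obtain mul where mul: "\<And>m n. computes rm [m, n] (mul m n)"
    "\<And>m n. \<nu> (mul m n) = \<nu> m \<otimes>\<^bsub>G\<^esub> \<nu> n" by metis
  have two: "map e [0..<2] = [e 0, e 1]" for e :: "nat \<Rightarrow> nat" by (simp add: numeral_2_eq_2)
  have "computable_fun 2 (\<lambda>e. mul (e 0) (e 1))" unfolding computable_fun_def two using mul(1) by blast
  note computable_mul = computable_comp2[OF this]
  obtain re where re: "\<forall>x\<in>UNIV. computes re (case x of (m, n) \<Rightarrow> [m, n])
        (if (case x of (m, n) \<Rightarrow> \<nu> m = \<nu> n) then 1 else 0)"
    using eq by blast
  have "computes re [m, n] (of_bool (\<nu> m = \<nu> n))" for m n
    using re[rule_format, of "(m, n)"] by (simp add: of_bool_def)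
  then have "computable_fun 2 (\<lambda>e. of_bool (\<nu> (e 0) = \<nu> (e 1)))" unfolding computable_fun_def two by blast
  from computable_comp2[OF this] have decidable_nu: "decidable_pred n (\<lambda>e. \<nu> (f e) = \<nu> (g e))"
    if "computable_fun n f" "computable_fun n g" for n f g
    using that unfolding decidable_pred_def by blast

  \<comment> \<open>The successor of the code \<open>S\<close> of the set of states stands in for
    the number of states, which makes the bound computable from the input.\<close>
  define B where "B = (\<lambda>S k. Suc S ^ Suc k * Suc (Suc k * Suc k) ^ (Suc k * Suc k))"
  define M where "M = (\<lambda>S I T k. Suc (S + I + T + B S k))"
  define L where "L = (\<lambda>S k. Suc (prod_encode (2 * k, prod_encode (k, B S k))))"
  define Q where "Q = (\<lambda>S I T k. \<exists>cl<M S I T k ^ L S k. \<exists>cx<M S I T k ^ L S k.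
    \<exists>ca<M S I T k ^ L S k. \<exists>cc<M S I T k ^ L S k.
      coded_legs \<nu> mul one S I T k (\<lambda>t j. table (M S I T k) cl t j 0) (table (M S I T k) cx)
        (table (M S I T k) ca) (table (M S I T k) cc))"
  have Q: "Q (set_encode (states W)) (set_encode (prod_encode ` t_init W))
      (set_encode (transition_encode ` transitions W)) k \<longleftrightarrow>
      \<not> branching_twinning G (denoted_automaton \<nu> W) k"
    (is "Q ?S ?I ?T k \<longleftrightarrow> _")
    if W: "weighted_automaton UNIV A W" for A W k
  proof -
    note \<nu> = equalityD1[OF range] one mul(2)
    show ?thesis unfolding not_branching_twinning_iff[OF \<nu>(1)]
    proof
      assume "Q ?S ?I ?T k"
      then show "\<exists>p \<tau>. separating_legs G \<nu> W k p \<tau>"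
        unfolding Q_def by (elim exE conjE) (drule coded_imp_separating_legs[OF \<nu> W], blast)
    next
      assume "\<exists>p \<tau>. separating_legs G \<nu> W k p \<tau>"
      then obtain p \<tau> where legs: "separating_legs G \<nu> W k p \<tau>" by blast
      have T: "transitions W \<subseteq> states W \<times> A \<times> UNIV \<times> states W" and fin: "finite (states W)"
        using W by (auto simp: weighted_automaton_def)
      \<comment> \<open>All states are below the code of their set, so there are at most that
        many.\<close>
      have "states W \<subseteq> {..<?S}" using set_decode_less[of _ ?S] fin by auto
      from card_mono[OF _ this] have "card (states W) \<le> Suc ?S" by simp
      from separating_legs_short[OF \<nu>(1) T fin legs this _ refl]
      obtain \<tau>' where \<tau>': "separating_legs G \<nu> W k p \<tau>'"
        "\<And>t j. t < 2 * k \<Longrightarrow> j \<le> k \<Longrightarrow> length (\<tau>' t j) \<le> B ?S k"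
        unfolding B_def by blast
      obtain x a c where "coded_legs \<nu> mul one ?S ?I ?T k (\<lambda>t j. length (\<tau>' t j)) x a c"
        using separating_legs_imp_coded[OF \<nu> W \<tau>'(1)] by blast
      from coded_legs_tables[OF this \<tau>'(2) refl refl] show "Q ?S ?I ?T k"
        unfolding Q_def M_def L_def by simp
    qed
  qed
  have computable_B: "computable_fun n (\<lambda>e. B (S e) (k e))"
    if "computable_fun n S" "computable_fun n k" for n S k
    unfolding B_def using that by (intro computable_intros)
  have computable_M: "computable_fun n (\<lambda>e. M (S e) (I e) (T e) (k e))"
    if "computable_fun n S" "computable_fun n I" "computable_fun n T" "computable_fun n k" for n S I T k
    unfolding M_def using that by (intro computable_intros computable_B)
  have computable_L: "computable_fun n (\<lambda>e. L (S e) (k e))"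
    if "computable_fun n S" "computable_fun n k" for n S k
    unfolding L_def using that by (intro computable_intros computable_B)
  \<comment> \<open>Positions 1, 2, 4 and 5 of the input hold the codes of the states, the initial
    pairs and the transitions, and the order \<open>k\<close>.\<close>
  have "decidable_pred 6 (\<lambda>e. \<not> Q (e 1) (e 2) (e 4) (e 5))"
    unfolding Q_def coded_legs_def
    by (intro decidable_not decidable_ex_less decidable_conj decidable_all_less
        decidable_imp decidable_mem_set_decode decidable_eq decidable_nu)
      ((intro computable_var computable_table computable_prod_encode computable_M computable_L
          computable_power computable_Suc computable_mult computable_const computable_add
          computable_rec computable_mul; simp; fail)+)
  then obtain r where r: "\<And>e. computes r (map e [0..<6]) (of_bool (\<not> Q (e 1) (e 2) (e 4) (e 5)))"
    unfolding decidable_pred_def computable_fun_def by blast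
  show ?thesis unfolding decidable_problem_def
  proof (intro exI ballI)
    fix x assume x: "x \<in> trimmed_inputs \<nu>"
    obtain A W k where [simp]: "x = (A, W, k)" by (cases x)
    \<comment> \<open>The program reads the first six values of the environment, here the components
      of the input list.\<close>
    have "map (\<lambda>i. input_encode x ! i) [0..<6] = input_encode x"
      by (simp add: eval_nat_numeral upt_conv_Cons)
    moreover have "weighted_automaton UNIV A W" using x by (simp add: trimmed_inputs_def)
    ultimately show "computes r (input_encode x)
        (if (case x of (A, W, k) \<Rightarrow> branching_twinning G (denoted_automaton \<nu> W) k) then 1 else 0)"
      using r[of "\<lambda>i. input_encode x ! i"] Q[of A W k] by (simp add: of_bool_def eval_nat_numeral)
  qed
qed

end
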